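(* Let $p(n)$ denote the number of partitions of $n$. For all integers $n>1$, \[ \frac{p(n-1)}{p(n)}\left(1+\frac{1}{n}\right) > \frac{p(n)}{p(n+1)}. \]
   Context: $p(n)$ is the partition function: the number of ways of writing $n$ as an unordered sum of positive integers. *)

theory Defs
  imports Complex_Main "HOL-Library.Multiset"
begin

definition partitions_of :: "nat \<Rightarrow> nat multiset set" where
  "partitions_of n = {M. (\<forall>x \<in># M. x > 0) \<and> sum_mset M = n}"

definition partition_number :: "nat \<Rightarrow> nat" where
  "partition_number n = card (partitions_of n)"

end

theory Submission
  imports Defs "HOL-Probability.Distributions" "HOL-Complex_Analysis.Complex_Analysis"
begin

text \<open>
  For \<open>n < 900\<close> the inequality is checked by computing \<open>p(n)\<close> with the pentagonal recurrence.

  For larger \<open>n\<close>, write \<open>\<Sum> p(k) z^k = exp (\<Sum> \<sigma>(N)/N z^N)\<close> and choose \<open>x = exp (-t)\<close> with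
  \<open>\<Sum> \<sigma>(N) x^N = n\<close>. Then \<open>p(n)\<close>, \<open>p(n + 1)\<close> and \<open>p(n - 1)\<close> are, up to the same normalization, the integrals
  over \<open>[-\<pi>, \<pi>]\<close> of \<open>H(\<theta>)\<close>, \<open>H(\<theta>) exp (-i\<theta>)\<close> and \<open>H(\<theta>) exp (i\<theta>)\<close>, where \<open>H\<close> is the generating function on
  the circle of radius \<open>x\<close> times \<open>exp (-in\<theta>)\<close>. Hence \<open>p(n)\<^sup>2 - p(n - 1) p(n + 1)\<close> is at most of order
  \<open>(\<integral> |H|) (\<integral> |H| (1 - cos \<theta>))\<close>. Since \<open>|H|\<close> is close to a Gaussian of variance of order \<open>t^3\<close>
  and \<open>t\<close> is of order \<open>n^(-1/2)\<close>, this is \<open>O(n^(-3/2)) p(n)\<^sup>2\<close>, while an error below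
  \<open>p(n)\<^sup>2 / (n + 1)\<close> suffices. So crude estimates of \<open>H\<close> are enough, and all of them follow from bounds
  on the moments \<open>\<Sum> N^j \<sigma>(N)/N x^N\<close> for \<open>j \<le> 3\<close>; no modular transformation is needed.
\<close>

unbundle no vec_syntax
unbundle fps_syntax

section \<open>Partitions and divisor sums\<close>

text \<open>This choice of x removes the linear term from the phase of H, so the remaining phase is
  cubic in \<theta>. If P0, P1, Pm are the normalized integrals for n, n + 1, n - 1, then P1 * Pm =
  b^2 - c^2 with b = (P1 + Pm)/2 and c = (P1 - Pm)/2. Here P0 - b integrates H (1 - cos \<theta>),
  and c integrates H sin \<theta> up to a unit factor; since (sin \<theta>)^2 \<le> 2 (1 - cos
  \<theta>), the weight 1 - cos \<theta> controls both. Errors are measured in the Gaussian width v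
  = t^(3/2): after multiplication by n + 1 they are constants times v^2 times (n + 1) v^2, and (n +
  1) v^2 is at most about (\<pi>^2/6) t. So the size of t decides how crude the constants may be.
  The bound t \<le> 43/1000 is small enough, and n t^2 \<le> \<pi>^2/6 provides it from n = 900 on.
  Only the lower bound for P0 has to deal with the phase; everywhere else |H| suffices.\<close>

definition bounded_partitions :: "nat \<Rightarrow> nat \<Rightarrow> nat multiset set" where
  "bounded_partitions m n = {M. (\<forall>x \<in># M. 0 < x \<and> x \<le> m) \<and> sum_mset M = n}"

lemma finite_partitions_of: "finite (partitions_of n)"
proof (induction n rule: less_induct)
  case (less n)
  have "partitions_of n \<subseteq> insert {#} (\<Union>k\<in>{1..n}. add_mset k ` partitions_of (n - k))"
  proof
    fix M assume M: "M \<in> partitions_of n"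
    show "M \<in> insert {#} (\<Union>k\<in>{1..n}. add_mset k ` partitions_of (n - k))"
    proof (cases M)
      case (add k N)
      with M have "k \<in> {1..n}" "N \<in> partitions_of (n - k)"
        by (auto simp: partitions_of_def Suc_le_eq)
      with add show ?thesis by blast
    qed simp
  qed
  moreover have "finite (\<Union>k\<in>{1..n}. add_mset k ` partitions_of (n - k))"
    using less.IH by auto
  ultimately show ?case by (meson finite.insertI finite_subset)
qed

lemma bounded_partitions_subset: "bounded_partitions m n \<subseteq> partitions_of n"
  by (auto simp: bounded_partitions_def partitions_of_def)

lemma finite_bounded_partitions: "finite (bounded_partitions m n)"
  using bounded_partitions_subset finite_partitions_of finite_subset by blast

lemma bounded_partitions_eq_partitions_of:
  assumes "n \<le> m" shows "bounded_partitions m n = partitions_of n"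
proof -
  have "x \<le> sum_mset M" if "x \<in># M" for x and M :: "nat multiset"
    using that by (metis le_add1 multi_member_split sum_mset.add_mset)
  then have "\<forall>x \<in># M. x \<le> m" if "sum_mset M = n" for M
    using assms that order_trans by blast
  then show ?thesis
    unfolding bounded_partitions_def partitions_of_def by blast
qed

lemma bounded_partitions_0: "bounded_partitions 0 n = (if n = 0 then {{#}} else {})"
proof -
  have "M = {#}" if "\<forall>x \<in># M. 0 < x \<and> x \<le> 0" for M :: "nat multiset"
    using that by (cases M) auto
  then have "{M. \<forall>x \<in># M. 0 < x \<and> x \<le> 0} = {{#} :: nat multiset}" by auto
  then have "bounded_partitions 0 n = {M \<in> {{#}}. sum_mset M = n}"
    unfolding bounded_partitions_def by blast
  moreover have "{y \<in> {a}. P y} = (if P a then {a} else {})" for P and a :: "nat multiset"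
    by auto
  ultimately show ?thesis by (simp only: sum_mset.empty eq_commute[of 0 n])
qed

lemma bounded_partitions_Suc:
  "bounded_partitions (Suc m) n = bounded_partitions m n \<union>
     (if Suc m \<le> n then add_mset (Suc m) ` bounded_partitions (Suc m) (n - Suc m) else {})"
  (is "?L = ?R")
proof
  show "?L \<subseteq> ?R"
  proof
    fix M assume M: "M \<in> ?L"
    show "M \<in> ?R"
    proof (cases "Suc m \<in># M")
      case True
      then obtain N where "M = add_mset (Suc m) N" by (meson multi_member_split)
      with M show ?thesis by (auto simp: bounded_partitions_def)
    next
      case False
      with M show ?thesis by (auto simp: bounded_partitions_def le_Suc_eq)
    qed
  qed
  show "?R \<subseteq> ?L" by (auto simp: bounded_partitions_def split: if_splits)
qed

lemma card_bounded_partitions_Suc: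
  "card (bounded_partitions (Suc m) n) = card (bounded_partitions m n) +
     (if Suc m \<le> n then card (bounded_partitions (Suc m) (n - Suc m)) else 0)"
proof (cases "Suc m \<le> n")
  case True
  let ?A = "add_mset (Suc m) ` bounded_partitions (Suc m) (n - Suc m)"
  have "Suc m \<notin># M" if "M \<in> bounded_partitions m n" for M
    using that Suc_n_not_le_n unfolding bounded_partitions_def by blast
  then have "bounded_partitions m n \<inter> ?A = {}"
    by fastforce
  then have "card (bounded_partitions m n \<union> ?A) = card (bounded_partitions m n) + card ?A"
    by (simp add: card_Un_disjoint finite_bounded_partitions)
  moreover have "card ?A = card (bounded_partitions (Suc m) (n - Suc m))"
    by (intro card_image) (auto simp: inj_on_def)
  ultimately show ?thesis
    using True by (simp add: bounded_partitions_Suc[of m n])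
next
  case False
  then show ?thesis by (simp add: bounded_partitions_Suc[of m n])
qed

lemma partition_number_0: "partition_number 0 = 1"
proof -
  have "partitions_of 0 = {{#}}"
    by (metis bounded_partitions_0 bounded_partitions_eq_partitions_of order_refl)
  then show ?thesis by (simp add: partition_number_def)
qed

lemma partition_number_pos: "partition_number n > 0"
proof -
  have "replicate_mset n 1 \<in> partitions_of n"
    by (auto simp: partitions_of_def)
  then show ?thesis
    unfolding partition_number_def using finite_partitions_of card_gt_0_iff by blast
qed

section \<open>Generating functions of partitions with bounded parts\<close>

definition bounded_gf :: "nat \<Rightarrow> int fps" where
  "bounded_gf m = Abs_fps (\<lambda>n. int (card (bounded_partitions m n)))"

text \<open>Up to degree m the bound on the parts is invisible, so finite products of factors 1/(1 -
  X^j) replace Euler's infinite product.\<close>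

lemma bounded_gf_nth: "n \<le> m \<Longrightarrow> bounded_gf m $ n = int (partition_number n)"
  by (simp add: bounded_gf_def partition_number_def bounded_partitions_eq_partitions_of)

lemma bounded_gf_0: "bounded_gf 0 = 1"
  by (rule fps_ext) (simp add: bounded_gf_def bounded_partitions_0)

lemma bounded_gf_Suc: "bounded_gf (Suc m) * (1 - fps_X ^ Suc m) = bounded_gf m"
proof (rule fps_ext)
  fix n
  have "(bounded_gf (Suc m) * (1 - fps_X ^ Suc m)) $ n
      = bounded_gf (Suc m) $ n - (if n < Suc m then 0 else bounded_gf (Suc m) $ (n - Suc m))"
    by (simp only: right_diff_distrib mult_1_right fps_sub_nth fps_X_power_mult_right_nth)
  then show "(bounded_gf (Suc m) * (1 - fps_X ^ Suc m)) $ n = bounded_gf m $ n"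
    by (auto simp: bounded_gf_def card_bounded_partitions_Suc[of m n])
qed

lemma bounded_gf_mult_prod: "bounded_gf m * (\<Prod>j=1..m. 1 - fps_X ^ j) = 1"
proof (induction m)
  case (Suc m)
  have "bounded_gf (Suc m) * (\<Prod>j=1..Suc m. 1 - fps_X ^ j)
      = (bounded_gf (Suc m) * (1 - fps_X ^ Suc m)) * (\<Prod>j=1..m. 1 - fps_X ^ j)"
    by (simp add: prod.nat_ivl_Suc' mult_ac)
  then show ?case by (simp only: bounded_gf_Suc Suc.IH)
qed (simp add: bounded_gf_0)

definition divisor_sum :: "nat \<Rightarrow> nat" where
  "divisor_sum n = \<Sum>{d. d dvd n}"

text \<open>Logarithmic differentiation of the product of 1/(1 - X^j), j \<le> m: the j-th factor
  contributes the series of j X^(j k), k \<ge> 1, so coefficient n collects the divisors d \<le> m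
  of n. Coefficient 0 is set separately because every d divides 0.\<close>

lemma bounded_gf_deriv:
  "fps_X * fps_deriv (bounded_gf m)
     = Abs_fps (\<lambda>n. if n = 0 then 0 else \<Sum>d | d dvd n \<and> d \<le> m. int d) * bounded_gf m"
  (is "_ = ?u m * _")
proof (induction m)
  case 0
  have "?u 0 = 0"
    by (rule fps_ext) (auto intro!: sum.neutral)
  then show ?case by (simp add: bounded_gf_0)
next
  case (Suc m)
  define w :: "int fps" where "w = 1 - fps_X ^ Suc m"
  have w_nz: "w \<noteq> 0"
  proof
    assume "w = 0"
    then have "w $ 0 = 0" by simp
    then show False by (simp add: w_def)
  qed
  \<comment> \<open>The new factor adds (m + 1) X^(m + 1) / (1 - X^(m + 1)). The equation is stated
    with the denominator \<open>w\<close> cleared; \<open>w\<close> is cancelled at the very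
    end.\<close>
  have step: "(?u (Suc m) - ?u m) * w = of_nat (Suc m) * fps_X ^ Suc m"
  proof -
    let ?v = "Abs_fps (\<lambda>n. if n \<noteq> 0 \<and> Suc m dvd n then int (Suc m) else 0)"
    have v: "?u (Suc m) - ?u m = ?v"
    proof (rule fps_ext)
      fix n
      show "(?u (Suc m) - ?u m) $ n = ?v $ n"
      proof (cases "n = 0")
        case False
        have "{d. d dvd n \<and> d \<le> Suc m}
            = {d. d dvd n \<and> d \<le> m} \<union> (if Suc m dvd n then {Suc m} else {})"
          by (auto simp: le_Suc_eq)
        then show ?thesis using False by (auto simp: sum.union_disjoint)
      qed simp
    qed
    have "(?v * w) $ n = ((of_nat (Suc m) :: int fps) * fps_X ^ Suc m) $ n" for n
    proof -
      have "(?v * w) $ n = ?v $ n - (if n < Suc m then 0 else ?v $ (n - Suc m))"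
        by (simp only: w_def right_diff_distrib mult_1_right fps_sub_nth fps_X_power_mult_right_nth)
      also have "\<dots> = (if n = Suc m then int (Suc m) else 0)"
      proof -
        consider "n < Suc m" | "n = Suc m" | "n > Suc m" by linarith
        then show ?thesis
        proof cases
          case 1
          then show ?thesis using dvd_imp_le[of "Suc m" n] by (cases "n = 0") auto
        next
          case 3
          then have "Suc m dvd n - Suc m \<longleftrightarrow> Suc m dvd n"
            by (metis dvd_minus_self less_imp_not_less)
          with 3 show ?thesis by simp
        qed simp
      qed
      also have "\<dots> = ((of_nat (Suc m) :: int fps) * fps_X ^ Suc m) $ n"
        by (subst fps_X_power_mult_right_nth) (auto simp: fps_nth_of_nat)
      finally show ?thesis .
    qed
    then show ?thesis unfolding v by (rule fps_ext)
  qed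
  have "fps_deriv w = - (of_nat (Suc m) * fps_X ^ m)"
    by (simp add: w_def fps_deriv_power fps_of_nat del: power_Suc of_nat_Suc)
  then have dw: "fps_X * fps_deriv w = - (of_nat (Suc m) * fps_X ^ Suc m)"
    by (simp only: mult_minus_right power_Suc mult.left_commute)
  define U U' g where "U = ?u m" and "U' = ?u (Suc m)" and "g = bounded_gf (Suc m)"
  have f: "bounded_gf m = g * w"
    using bounded_gf_Suc w_def g_def by metis
  have "U * (g * w) = fps_X * fps_deriv (g * w)"
    using Suc.IH unfolding f U_def by (rule sym)
  also have "\<dots> = (fps_X * fps_deriv g) * w + g * (fps_X * fps_deriv w)"
    by (simp only: fps_deriv_mult) (simp only: algebra_simps)
  also have "fps_X * fps_deriv w = - ((U' - U) * w)"
    unfolding U_def U'_def step dw ..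
  finally have "(fps_X * fps_deriv g) * w = (U' * g) * w"
    by (auto simp: algebra_simps)
  then have "fps_X * fps_deriv g = U' * g"
    using w_nz by (metis mult_cancel_right)
  then show ?case unfolding g_def U'_def .
qed

text \<open>Coefficient n of the logarithmic derivative, with part bound n. Together with p(0) = 1
  this recurrence determines p, which later identifies the Taylor coefficients of the exponential of
  the divisor series.\<close>

lemma partition_number_divisor_sum:
  "n * partition_number n = (\<Sum>k=1..n. divisor_sum k * partition_number (n - k))"
proof (cases "n = 0")
  case False
  let ?u = "Abs_fps (\<lambda>k. if k = 0 then 0 else \<Sum>d | d dvd k \<and> d \<le> n. int d)"
  have u: "?u $ k = int (divisor_sum k)" if "k \<in> {1..n}" for k
  proof -
    have "d \<le> n" if "d dvd k" for d
      using dvd_imp_le[OF that] \<open>k \<in> {1..n}\<close> by auto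
    then have "{d. d dvd k \<and> d \<le> n} = {d. d dvd k}" by blast
    then show ?thesis using that by (simp add: divisor_sum_def)
  qed
  have "int (n * partition_number n) = (fps_X * fps_deriv (bounded_gf n)) $ n"
    using False bounded_gf_nth[of n n] by (cases n) (simp_all add: algebra_simps)
  also have "\<dots> = (\<Sum>k=0..n. ?u $ k * bounded_gf n $ (n - k))"
    unfolding bounded_gf_deriv fps_mult_nth ..
  also have "\<dots> = (\<Sum>k=1..n. ?u $ k * bounded_gf n $ (n - k))"
    by (rule sum.mono_neutral_right) auto
  also have "\<dots> = (\<Sum>k=1..n. int (divisor_sum k * partition_number (n - k)))"
    using u by (intro sum.cong) (auto simp: bounded_gf_nth)
  also have "\<dots> = int (\<Sum>k=1..n. divisor_sum k * partition_number (n - k))" by simp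
  finally show ?thesis by (simp only: of_nat_eq_iff)
qed simp

section \<open>The pentagonal recurrence and small values\<close>

definition triangular :: "nat \<Rightarrow> nat" where
  "triangular n = n * (n + 1) div 2"

lemma triangular_0: "triangular 0 = 0"
  by (simp add: triangular_def)

lemma triangular_Suc: "triangular (Suc n) = triangular n + Suc n"
proof -
  have eq: "Suc n * (Suc n + 1) = n * (n + 1) + Suc n * 2" by simp
  show ?thesis
    unfolding triangular_def eq by (subst div_mult_self1) simp_all
qed

lemma triangular_mono: "m \<le> n \<Longrightarrow> triangular m \<le> triangular n"
  unfolding triangular_def by (intro div_le_mono mult_le_mono) auto

text \<open>Shanks' finite form of the pentagonal number theorem. The generalized pentagonal numbers
  \<open>j(3j - 1)/2\<close> and \<open>j(3j + 1)/2\<close> appear as \<open>j\<^sup>2\<close> plus a triangular number, here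
  with \<open>j = i + 1\<close>.\<close>
lemma shanks_identity:
  fixes x :: "'a :: comm_ring_1"
  shows "(\<Sum>s\<le>m. (-1) ^ s * x ^ (s * m + triangular s) * (\<Prod>j=Suc s..m. 1 - x ^ j))
    = 1 + (\<Sum>i<m. (-1) ^ Suc i * (x ^ ((Suc i)\<^sup>2 + triangular i) + x ^ ((Suc i)\<^sup>2 + triangular (Suc i))))"
proof (induction m)
  case 0
  then show ?case by (simp add: triangular_0)
next
  case (Suc m)
  define Q where "Q s = (\<Prod>j=Suc s..m. 1 - x ^ j)" for s
  define a where "a s = (-1) ^ s * x ^ (s * m + triangular s) * Q s" for s
  define c where "c s = (-1) ^ s * x ^ (s * Suc m + triangular s) * Q s" for s
  define d where "d s = (-1) ^ s * x ^ (Suc s * Suc m + triangular s) * Q s" for s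
  have cd: "(-1) ^ s * x ^ (s * Suc m + triangular s) * (\<Prod>j=Suc s..Suc m. 1 - x ^ j) = c s - d s"
    if "s \<le> m" for s
  proof -
    have Q: "(\<Prod>j=Suc s..Suc m. 1 - x ^ j) = Q s * (1 - x ^ Suc m)"
      using that by (simp add: Q_def prod.nat_ivl_Suc' mult.commute)
    show ?thesis
      unfolding Q by (simp add: c_def d_def algebra_simps power_add)
  qed
  \<comment> \<open>Raising m by one multiplies the power of x in term r + 1 by x^(r + 1). The
    difference carries the factor 1 - x^(r + 1), which completes \<open>Q (Suc r)\<close> to
    \<open>Q r\<close>. So the sums of \<open>c - a\<close> and of \<open>d\<close> cancel except
    for \<open>d m\<close>.\<close>
  have ca: "c (Suc r) - a (Suc r) = d r" if "r < m" for r
  proof -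
    have Q: "Q r = (1 - x ^ Suc r) * Q (Suc r)"
      unfolding Q_def using that by (simp add: prod.atLeast_Suc_atMost)
    show ?thesis
      unfolding d_def Q by (simp add: c_def a_def d_def algebra_simps power_add triangular_Suc)
  qed
  have c0: "c 0 = a 0" by (simp add: c_def a_def triangular_0)
  have split: "(\<Sum>s\<le>m. f s) = f 0 + (\<Sum>r<m. f (Suc r))" for f :: "nat \<Rightarrow> 'a"
    by (simp add: sum.atMost_shift)
  have "(\<Sum>s\<le>m. c s - d s) = (\<Sum>s\<le>m. a s) + (\<Sum>s\<le>m. c s - a s) - (\<Sum>s\<le>m. d s)"
    by (simp add: sum_subtractf)
  also have "(\<Sum>s\<le>m. c s - a s) = (\<Sum>r<m. d r)"
    unfolding split using c0 ca by simp
  also have "(\<Sum>s\<le>m. d s) = (\<Sum>r<m. d r) + d m"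
    by (simp add: lessThan_Suc_atMost[symmetric])
  finally have main: "(\<Sum>s\<le>m. c s - d s) = (\<Sum>s\<le>m. a s) - d m" by simp
  have "(\<Sum>s\<le>Suc m. (-1) ^ s * x ^ (s * Suc m + triangular s) * (\<Prod>j=Suc s..Suc m. 1 - x ^ j))
      = (\<Sum>s\<le>m. c s - d s) + (-1) ^ Suc m * x ^ ((Suc m)\<^sup>2 + triangular (Suc m))"
    using cd by (simp add: power2_eq_square)
  \<comment> \<open>The leftover \<open>- d m\<close> and the new term s = m + 1 are the two
    pentagonal powers of index m + 1.\<close>
  also have "\<dots> = (\<Sum>s\<le>m. a s)
      + (-1) ^ Suc m * (x ^ ((Suc m)\<^sup>2 + triangular m) + x ^ ((Suc m)\<^sup>2 + triangular (Suc m)))"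
    unfolding main by (simp add: d_def Q_def power2_eq_square algebra_simps)
  finally show ?case
    using Suc.IH by (simp add: a_def Q_def)
qed

text \<open>Multiply Shanks' identity at x = X by \<open>bounded_gf n\<close> and read off
  coefficient n. The term s = 0 is the full product and becomes 1, whose coefficient n vanishes as 0
  < n; the terms s \<ge> 1 start beyond degree n. The condition on J says that the next pair of
  pentagonal numbers exceeds n.\<close>

lemma partition_number_pentagonal:
  fixes J :: nat
  assumes "0 < n" and "n < (Suc J)\<^sup>2 + triangular J"
  defines "r \<equiv> \<lambda>g. if g \<le> n then int (partition_number (n - g)) else 0"
  shows "int (partition_number n)
    = (\<Sum>i<J. (-1) ^ i * (r ((Suc i)\<^sup>2 + triangular i) + r ((Suc i)\<^sup>2 + triangular (Suc i))))"
proof -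
  let ?X = "fps_X :: int fps"
  define D where "D = (\<Prod>j=1..n. 1 - ?X ^ j)"
  define T where "T s = (-1) ^ s * ?X ^ (s * n + triangular s) * (\<Prod>j=Suc s..n. 1 - ?X ^ j)" for s
  have T0: "T 0 = D" by (simp add: T_def D_def triangular_0)
  have "(bounded_gf n * T s) $ n = 0" if "s \<in> {1..n}" for s
  proof -
    have gt: "n < s * n + triangular s"
    proof -
      have "1 * n \<le> s * n" using that by (intro mult_le_mono1) simp
      moreover have "triangular 1 \<le> triangular s" using that by (intro triangular_mono) simp
      then have "0 < triangular s" by (simp add: triangular_def)
      ultimately show ?thesis by linarith
    qed
    have "bounded_gf n * T s = (bounded_gf n * ((-1) ^ s * (\<Prod>j=Suc s..n. 1 - ?X ^ j)))
        * ?X ^ (s * n + triangular s)"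
      by (simp add: T_def mult_ac)
    then show ?thesis
      using gt by (simp only: fps_X_power_mult_right_nth) simp
  qed
  moreover have "(\<Sum>s\<le>n. T s) = D + (\<Sum>s=1..n. T s)"
    using T0 by (simp add: atMost_atLeast0 sum.atLeast_Suc_atMost)
  ultimately have "(bounded_gf n * (\<Sum>s\<le>n. T s)) $ n = (bounded_gf n * D) $ n"
    by (simp add: ring_distribs sum_distrib_left fps_sum_nth)
  also have "\<dots> = 0"
    unfolding D_def bounded_gf_mult_prod using assms by simp
  also have "(\<Sum>s\<le>n. T s) = 1 + (\<Sum>i<n. (-1) ^ Suc i *
      (?X ^ ((Suc i)\<^sup>2 + triangular i) + ?X ^ ((Suc i)\<^sup>2 + triangular (Suc i))))"
    unfolding T_def by (rule shanks_identity)
  finally have 0: "0 = (bounded_gf n * (1 + (\<Sum>i<n. (-1) ^ Suc i *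
      (?X ^ ((Suc i)\<^sup>2 + triangular i) + ?X ^ ((Suc i)\<^sup>2 + triangular (Suc i)))))) $ n" ..
  have r: "(bounded_gf n * ?X ^ g) $ n = r g" for g
    unfolding fps_X_power_mult_right_nth r_def by (simp add: bounded_gf_nth)
  have sgn: "(f * ((-1) ^ k * h)) $ m = (-1) ^ k * (f * h) $ m" for f h :: "int fps" and k m
    by (cases "even k") auto
  define t where "t i = (-1) ^ i * (r ((Suc i)\<^sup>2 + triangular i) + r ((Suc i)\<^sup>2 + triangular (Suc i)))" for i
  have "0 = int (partition_number n) + (\<Sum>i<n. - t i)"
    unfolding 0 t_def distrib_left[of "bounded_gf n"] sum_distrib_left fps_add_nth fps_sum_nth sgn r
    by (simp add: bounded_gf_nth)
  then have n: "int (partition_number n) = (\<Sum>i<n. t i)" by (simp add: sum_negf)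
  have big: "t i = 0" if "n < (Suc i)\<^sup>2 + triangular i" for i
    using that by (simp add: t_def r_def triangular_Suc)
  have "(\<Sum>i<n. t i) = (\<Sum>i<max n J. t i)"
  proof (rule sum.mono_neutral_left)
    show "\<forall>i\<in>{..<max n J} - {..<n}. t i = 0"
      by (intro ballI big) (auto simp: power2_eq_square)
  qed auto
  also have "\<dots> = (\<Sum>i<J. t i)"
  proof (rule sum.mono_neutral_right)
    show "\<forall>i\<in>{..<max n J} - {..<J}. t i = 0"
    proof
      fix i assume "i \<in> {..<max n J} - {..<J}"
      then have "J \<le> i" by auto
      then have "(Suc J)\<^sup>2 + triangular J \<le> (Suc i)\<^sup>2 + triangular i"
        by (intro add_mono power_mono triangular_mono) auto
      then show "t i = 0" using assms(2) by (intro big) linarith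
    qed
  qed auto
  finally show ?thesis unfolding n t_def .
qed

section \<open>The recurrence evaluated by walking along the list of earlier values\<close>

datatype token = Skip8 | Skip | Plus | Minus

text \<open>The long skips keep the number of rewrite steps on the list of known values small.\<close>
fun walk :: "int \<Rightarrow> token list \<Rightarrow> int list \<Rightarrow> int" where
  "walk s ts [] = s"
| "walk s [] (x # xs) = s"
| "walk s (Plus # ts) (x # xs) = walk (s + x) ts xs"
| "walk s (Minus # ts) (x # xs) = walk (s - x) ts xs"
| "walk s (Skip # ts) (x # xs) = walk s ts xs"
| "walk s (Skip8 # ts) (x # xs) = walk s ts (tl (tl (tl (tl (tl (tl (tl xs)))))))"

definition skips :: "nat \<Rightarrow> token list" where
  "skips d = replicate (d div 8) Skip8 @ replicate (d mod 8) Skip"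

text \<open>The gaps between successive generalized pentagonal numbers are 2i + 1 and i + 1, and a
  sign token itself uses up one entry, so 2i and i entries are skipped. The concatenated blocks are
  one fixed program for all n, without indexing into the list.\<close>

definition pentagonal_block :: "nat \<Rightarrow> token list" where
  "pentagonal_block i = skips (2 * i) @ (if even i then Plus else Minus) #
                        skips i @ [if even i then Plus else Minus]"

text \<open>The default 0 stands for p at negative arguments and agrees with \<open>walk\<close>,
  which stops when the list is exhausted.\<close>

definition nth0 :: "int list \<Rightarrow> nat \<Rightarrow> int" where
  "nth0 xs k = (if k < length xs then xs ! k else 0)"

lemma walk_Skip: "walk s (Skip # ts) xs = walk s ts (drop 1 xs)"
  by (cases xs) auto

lemma walk_Skip8: "walk s (Skip8 # ts) xs = walk s ts (drop 8 xs)"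
  by (cases xs) (simp_all add: drop_Suc numeral_eq_Suc)

lemma walk_sign: "walk s ((if b then Plus else Minus) # ts) xs
    = walk (s + (if b then 1 else -1) * nth0 xs 0) ts (drop 1 xs)"
  by (cases xs) (auto simp: nth0_def)

lemma walk_replicate_Skip: "walk s (replicate d Skip @ ts) xs = walk s ts (drop d xs)"
  by (induction d arbitrary: xs) (simp_all add: walk_Skip del: walk.simps)

lemma walk_replicate_Skip8: "walk s (replicate d Skip8 @ ts) xs = walk s ts (drop (8 * d) xs)"
  by (induction d arbitrary: xs) (simp_all add: walk_Skip8 add.commute del: walk.simps)

lemma walk_skips: "walk s (skips d @ ts) xs = walk s ts (drop d xs)"
  by (simp add: skips_def walk_replicate_Skip walk_replicate_Skip8 del: walk.simps)

lemma nth0_drop: "nth0 (drop d xs) k = nth0 xs (d + k)"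
  by (auto simp: nth0_def less_diff_conv add.commute)

lemma walk_pentagonal_block:
  "walk s (pentagonal_block i @ ts) (drop (i\<^sup>2 + triangular i) xs)
    = walk (s + (-1) ^ i * (nth0 xs ((Suc i)\<^sup>2 + triangular i - 1) + nth0 xs ((Suc i)\<^sup>2 + triangular (Suc i) - 1)))
        ts (drop ((Suc i)\<^sup>2 + triangular (Suc i)) xs)"
proof -
  have e: "(if even i then 1 else - 1) = (-1 :: int) ^ i" by simp
  have "i\<^sup>2 + triangular i + 2 * i = (Suc i)\<^sup>2 + triangular i - 1"
       "i\<^sup>2 + triangular i + 2 * i + 1 + i = (Suc i)\<^sup>2 + triangular (Suc i) - 1"
       "i\<^sup>2 + triangular i + 2 * i + 1 + i + 1 = (Suc i)\<^sup>2 + triangular (Suc i)"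
    by (simp_all add: power2_eq_square triangular_Suc)
  note eqs = this
  show ?thesis
    unfolding pentagonal_block_def append_assoc append_Cons append_Nil walk_skips walk_sign
      drop_drop nth0_drop e
    using eqs by (simp add: algebra_simps)
qed

lemma walk_pentagonal_blocks:
  "walk s (concat (map pentagonal_block [i..<i + c])) (drop (i\<^sup>2 + triangular i) xs)
    = s + (\<Sum>j=i..<i + c. (-1) ^ j * (nth0 xs ((Suc j)\<^sup>2 + triangular j - 1)
                                  + nth0 xs ((Suc j)\<^sup>2 + triangular (Suc j) - 1)))"
proof (induction c arbitrary: s i)
  case 0
  then show ?case by (cases "drop (i\<^sup>2 + triangular i) xs") auto
next
  case (Suc c)
  have "[i..<i + Suc c] = i # [Suc i..<Suc i + c]"
    by (simp add: upt_conv_Cons)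
  then show ?case
    using Suc.IH[of _ "Suc i"]
    by (simp add: walk_pentagonal_block sum.atLeast_Suc_lessThan del: upt_Suc walk.simps)
qed

lemma walk_partition_numbers:
  assumes "n + 1 < (Suc J)\<^sup>2 + triangular J"
  shows "walk 0 (concat (map pentagonal_block [0..<J])) (map (\<lambda>k. int (partition_number k)) (rev [0..<Suc n]))
    = int (partition_number (n + 1))"
proof -
  define xs where "xs = map (\<lambda>k. int (partition_number k)) (rev [0..<Suc n])"
  \<comment> \<open>The head of the list is p(n), so p(n + 1 - g) sits at index g - 1.\<close>
  have nth0: "nth0 xs (g - 1) = (if g \<le> n + 1 then int (partition_number (n + 1 - g)) else 0)"
    if "0 < g" for g
    using that by (auto simp: xs_def nth0_def rev_nth simp del: upt_Suc)
  have "walk 0 (concat (map pentagonal_block [0..<J])) xs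
     = (\<Sum>j<J. (-1) ^ j * (nth0 xs ((Suc j)\<^sup>2 + triangular j - 1)
                                  + nth0 xs ((Suc j)\<^sup>2 + triangular (Suc j) - 1)))"
    using walk_pentagonal_blocks[of 0 0 J xs] by (simp add: triangular_0 atLeast0LessThan)
  also have "\<dots> = int (partition_number (n + 1))"
    unfolding partition_number_pentagonal[OF zero_less_Suc[of n, unfolded Suc_eq_plus1] assms]
    by (intro sum.cong refl) (simp add: nth0 del: One_nat_def)
  finally show ?thesis unfolding xs_def .
qed

text \<open>The list holds \<open>p(n), p(n - 1), \<dots>, p(0)\<close>. The new value is passed to \<open>check_next\<close> as an argument
  so that it is normalized once before it is duplicated.\<close>
fun check_from :: "token list \<Rightarrow> nat \<Rightarrow> int \<Rightarrow> int list \<Rightarrow> bool"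
  and check_next :: "token list \<Rightarrow> nat \<Rightarrow> int \<Rightarrow> int \<Rightarrow> int list \<Rightarrow> bool" where
  "check_from ts 0 n xs = True"
| "check_from ts (Suc k) n xs = check_next ts k n (walk 0 ts xs) xs"
| "check_next ts k n c (b # a # xs) =
     (n * (b * b) < (n + 1) * (a * c) \<and> check_from ts k (n + 1) (c # b # a # xs))"
| "check_next ts k n c [] = False"
| "check_next ts k n c [x] = False"

lemma check_from_sound:
  assumes "n + k < (Suc J)\<^sup>2 + triangular J" and "0 < n"
    and "check_from (concat (map pentagonal_block [0..<J])) k (int n) (map (\<lambda>k. int (partition_number k)) (rev [0..<Suc n]))"
    and "n \<le> m" and "m < n + k"
  shows "m * (partition_number m)\<^sup>2 < (m + 1) * (partition_number (m - 1) * partition_number (m + 1))"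
  using assms
proof (induction k arbitrary: n)
  case (Suc k)
  let ?p = "\<lambda>k. int (partition_number k)"
  let ?xs = "\<lambda>n. map ?p (rev [0..<Suc n])"
  let ?ts = "concat (map pentagonal_block [0..<J])"
  from Suc.prems(2) obtain l where n: "n = Suc l" using gr0_implies_Suc by blast
  have xs: "?xs n = ?p n # ?p l # map ?p (rev [0..<l])" by (simp add: n)
  have "walk 0 ?ts (?xs n) = ?p (n + 1)"
    using Suc.prems(1) by (intro walk_partition_numbers) simp
  then have "check_next ?ts k (int n) (?p (n + 1)) (?xs n)"
    using Suc.prems(3) by (simp only: check_from.simps)
  then have now: "int n * (?p n * ?p n) < (int n + 1) * (?p l * ?p (n + 1))"
    and later: "check_from ?ts k (int n + 1) (?p (n + 1) # ?xs n)"
    unfolding xs by (simp_all only: check_next.simps)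
  show ?case
  proof (cases "m = n")
    case True
    have "int (m * (partition_number m)\<^sup>2) < int ((m + 1) * (partition_number (m - 1) * partition_number (m + 1)))"
      using now by (simp add: True n power2_eq_square algebra_simps)
    then show ?thesis by (simp only: of_nat_less_iff)
  next
    case False
    have "?p (n + 1) # ?xs n = ?xs (n + 1)" by simp
    then have "check_from ?ts k (int (n + 1)) (?xs (n + 1))"
      using later by (simp add: add.commute)
    with Suc.prems False show ?thesis by (intro Suc.IH[of "n + 1"]) auto
  qed
qed simp

lemma partition_number_1: "partition_number 1 = 1"
  using partition_number_divisor_sum[of 1] by (simp add: divisor_sum_def partition_number_0)

text \<open>The list is p(1), p(0), and 899 rounds cover n = 1 to 899. \<open>code_simp\<close>
  evaluates by rewriting through the kernel, so each step costs; this explains the design of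
  \<open>walk\<close>.\<close>

lemma check_small: "check_from (concat (map pentagonal_block [0..<24])) 899 1 [1, 1]"
  by code_simp

lemma partition_number_ratio_small:
  assumes "1 \<le> n" "n < 900"
  shows "n * (partition_number n)\<^sup>2 < (n + 1) * (partition_number (n - 1) * partition_number (n + 1))"
\<comment> \<open>24 blocks suffice for all values up to p(900), since 25^2 + 24 * 25/2 =
  925.\<close>
proof (rule check_from_sound[where n = 1 and k = 899 and J = 24])
  have "map (\<lambda>k. int (partition_number k)) (rev [0..<Suc 1]) = [1, 1]"
    using partition_number_0 partition_number_1 by simp
  then show "check_from (concat (map pentagonal_block [0..<24])) 899 (int 1)
      (map (\<lambda>k. int (partition_number k)) (rev [0..<Suc 1]))"
    using check_small by simp
qed (use assms in \<open>auto simp: triangular_def\<close>)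

section \<open>Moments of the logarithm of the generating function\<close>

text \<open>For the infinite series this is an equality, by an index shift; the term k = 0 vanishes
  because j > 0. Truncation turns it into an inequality in the useful direction, so upper bounds
  need no limits.\<close>

lemma sum_power_mult_shift_le:
  fixes q :: real
  assumes "0 \<le> q" "0 < j"
  shows "(\<Sum>k\<le>M. real k ^ j * q ^ k) \<le> q * (\<Sum>k\<le>M. (real k + 1) ^ j * q ^ k)"
proof -
  have "(\<Sum>k\<le>M. real k ^ j * q ^ k) \<le> (\<Sum>k\<le>Suc M. real k ^ j * q ^ k)"
    using assms by simp
  also have "\<dots> = (\<Sum>k\<le>M. real (Suc k) ^ j * q ^ Suc k)"
    using assms by (simp add: sum.atMost_Suc_shift del: sum.atMost_Suc)
  also have "\<dots> = q * (\<Sum>k\<le>M. (real k + 1) ^ j * q ^ k)"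
    by (simp add: sum_distrib_left mult_ac add.commute)
  finally show ?thesis .
qed

text \<open>The right side is 4 sinh(s/2)^2, whose Taylor coefficients are nonnegative, so the
  series may be truncated. The terms up to s^4 serve the second moment, the s^6 term the
  third.\<close>

lemma exp_plus_exp_minus_ge:
  fixes s :: real
  assumes "s > 0"
  shows "s\<^sup>2 + s ^ 4 / 12 + s ^ 6 / 360 \<le> exp s + exp (- s) - 2"
proof -
  have "(\<lambda>n. s ^ n /\<^sub>R fact n + (- s) ^ n /\<^sub>R fact n) sums (exp s + exp (- s))"
    by (intro sums_add exp_converges)
  moreover have "0 \<le> s ^ n /\<^sub>R fact n + (- s) ^ n /\<^sub>R fact n" for n
  proof (cases "even n")
    case False
    then show ?thesis by (simp add: power_minus_odd)
  qed (use assms in auto)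
  ultimately have le: "(\<Sum>n<7. s ^ n /\<^sub>R fact n + (- s) ^ n /\<^sub>R fact n) \<le> exp s + exp (- s)"
    by (intro sums_le[OF _ sums_If_finite_set, of "{..<7}"]) auto
  have "{..<7} = {0, 1, 2, 3, 4, 5, 6 :: nat}" by auto
  with le have "2 * (1 + s ^ 2 / 2 + s ^ 4 / 24 + s ^ 6 / 720) \<le> exp s + exp (- s)"
    by (simp add: fact_numeral field_simps)
  then show ?thesis by (simp add: field_simps)
qed

lemma exp_plus_exp_minus_le:
  fixes t :: real
  assumes "0 < t" "t \<le> 1 / 20"
  shows "exp t + exp (- t) - 2 \<le> 2001 / 2000 * t\<^sup>2"
proof -
  have b: "\<exists>c. c \<le> 2 \<and> exp x = 1 + x + x\<^sup>2 / 2 + x ^ 3 / 6 + c / 24 * x ^ 4" if "\<bar>x\<bar> \<le> 1 / 20" for x :: real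
  proof -
    obtain c where c: "\<bar>c\<bar> \<le> \<bar>x\<bar>" "exp x = (\<Sum>m<4. x ^ m / fact m) + exp c / fact 4 * x ^ 4"
      using Maclaurin_exp_le[of x 4] by auto
    have "exp c \<le> 1 + 2 * (1 / 20)"
    proof -
      have "exp c \<le> exp (1 / 20)" using c that by simp
      also have "\<dots> \<le> 1 + 2 * (1 / 20 :: real)"
        using exp_bound_lemma[of "1 / 20 :: real"] by simp
      finally show ?thesis .
    qed
    moreover have "exp x = 1 + x + x\<^sup>2 / 2 + x ^ 3 / 6 + exp c / 24 * x ^ 4"
      using c(2) by (simp add: eval_nat_numeral fact_numeral)
    ultimately show ?thesis by (intro exI[of _ "exp c"]) auto
  qed
  obtain c where c: "c \<le> 2" "exp t = 1 + t + t\<^sup>2 / 2 + t ^ 3 / 6 + c / 24 * t ^ 4"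
    using b[of t] assms by auto
  obtain d where d: "d \<le> 2" "exp (- t) = 1 + (- t) + (- t)\<^sup>2 / 2 + (- t) ^ 3 / 6 + d / 24 * (- t) ^ 4"
    using b[of "- t"] assms by auto
  have "exp t + exp (- t) - 2 = t\<^sup>2 + (c + d) / 24 * t ^ 4"
    unfolding c(2) d(2) by (simp add: field_simps)
  also have "\<dots> \<le> t\<^sup>2 + 4 / 24 * t ^ 4"
    using c(1) d(1) by (intro add_left_mono mult_right_mono) auto
  also have "\<dots> \<le> t\<^sup>2 + 1 / 2000 * t\<^sup>2"
  proof -
    have "t\<^sup>2 \<le> (1 / 20)\<^sup>2" using assms by (intro power_mono) auto
    then have "t\<^sup>2 * t\<^sup>2 \<le> (1 / 20)\<^sup>2 * t\<^sup>2" by (intro mult_right_mono) auto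
    then have "t ^ 4 \<le> 1 / 400 * t\<^sup>2" by (simp add: power2_eq_square eval_nat_numeral)
    then show ?thesis using zero_le_power2[of t] by linarith
  qed
  finally show ?thesis by simp
qed

text \<open>With q = exp(-s) and E = (1 - q)^2/q the full series are 1/E, sqrt((E + 4)/E^3) and (E +
  6)/E^2, so the claims compare E with s^2. The constants 1 and 2 are the limits j! as s tends to 0.
  For j = 3 the full series slightly exceeds 6/s^4 for small s, hence 25/4.\<close>

lemma exponential_moment_sums:
  fixes s :: real
  assumes "0 < s"
  shows "(\<Sum>k\<le>M. real k * exp (- s) ^ k) \<le> 1 / s\<^sup>2"
    and "(\<Sum>k\<le>M. real k ^ 2 * exp (- s) ^ k) \<le> 2 / s ^ 3"
    and "(\<Sum>k\<le>M. real k ^ 3 * exp (- s) ^ k) \<le> 25 / 4 / s ^ 4"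
proof -
  define q where "q = exp (- s)"
  define E where "E = exp s + exp (- s) - 2"
  have q: "0 < q" "q < 1" using assms by (auto simp: q_def)
  define S where "S j = (\<Sum>k\<le>M. real k ^ j * q ^ k)" for j
  have E_q: "E * q = (1 - q)\<^sup>2"
    by (simp add: E_def q_def power2_eq_square algebra_simps flip: exp_add)
  have E_ge: "s\<^sup>2 + s ^ 4 / 12 + s ^ 6 / 360 \<le> E"
    using exp_plus_exp_minus_ge[OF assms] by (simp add: E_def)
  have pos: "0 < s\<^sup>2" "0 < s ^ 4" "0 < s ^ 6" using assms by auto
  then have E: "s\<^sup>2 \<le> E" "0 < E" using E_ge by linarith+
  have S0: "S 0 * (1 - q) \<le> 1"
  proof -
    have "S 0 * (1 - q) = 1 - q ^ Suc M"
      using q by (simp add: S_def sum_gp0)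
    then show ?thesis using q by simp
  qed
  have shift: "S j \<le> q * (\<Sum>k\<le>M. (real k + 1) ^ j * q ^ k)" if "0 < j" for j
    unfolding S_def using q that by (intro sum_power_mult_shift_le) auto
  have e1: "(\<Sum>k\<le>M. (real k + 1) ^ 1 * q ^ k) = S 1 + S 0"
    unfolding S_def sum_distrib_left sum.distrib[symmetric]
    by (intro sum.cong refl) (simp add: algebra_simps)
  have S1: "S 1 * (1 - q) \<le> q * S 0"
    using shift[of 1] unfolding e1 by (simp add: algebra_simps)
  have e2: "(\<Sum>k\<le>M. (real k + 1) ^ 2 * q ^ k) = S 2 + 2 * S 1 + S 0"
    unfolding S_def sum_distrib_left sum.distrib[symmetric]
    by (intro sum.cong refl) (simp add: power2_eq_square algebra_simps)
  have S2: "S 2 * (1 - q) \<le> q * (2 * S 1 + S 0)"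
    using shift[of 2] unfolding e2 by (simp add: algebra_simps)
  have e3: "(\<Sum>k\<le>M. (real k + 1) ^ 3 * q ^ k) = S 3 + 3 * S 2 + 3 * S 1 + S 0"
    unfolding S_def sum_distrib_left sum.distrib[symmetric]
    by (intro sum.cong refl) (simp add: power2_eq_square power3_eq_cube algebra_simps)
  have S3: "S 3 * (1 - q) \<le> q * (3 * S 2 + 3 * S 1 + S 0)"
    using shift[of 3] unfolding e3 by (simp add: algebra_simps)
  have b1: "S 1 * (1 - q)\<^sup>2 \<le> q"
  proof -
    have "S 1 * (1 - q)\<^sup>2 = (S 1 * (1 - q)) * (1 - q)" by (simp add: power2_eq_square)
    also have "\<dots> \<le> q * S 0 * (1 - q)" using S1 q by (intro mult_right_mono) auto
    also have "\<dots> = q * (S 0 * (1 - q))" by simp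
    also have "\<dots> \<le> q * 1" using S0 q by (intro mult_left_mono) auto
    finally show ?thesis by simp
  qed
  have b2: "S 2 * (1 - q) ^ 3 \<le> q * (1 + q)"
  proof -
    have "S 2 * (1 - q) ^ 3 = (S 2 * (1 - q)) * (1 - q)\<^sup>2" by (simp add: power2_eq_square power3_eq_cube)
    also have "\<dots> \<le> q * (2 * S 1 + S 0) * (1 - q)\<^sup>2" using S2 by (intro mult_right_mono) auto
    also have "\<dots> = q * (2 * (S 1 * (1 - q)\<^sup>2) + (S 0 * (1 - q)) * (1 - q))"
      by (simp add: power2_eq_square algebra_simps)
    also have "\<dots> \<le> q * (2 * q + 1 * (1 - q))"
      using b1 S0 q by (intro mult_left_mono add_mono mult_right_mono) auto
    finally show ?thesis by (simp add: add.commute)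
  qed
  have b3: "S 3 * (1 - q) ^ 4 \<le> q * (1 + 4 * q + q\<^sup>2)"
  proof -
    have "S 3 * (1 - q) ^ 4 = (S 3 * (1 - q)) * (1 - q) ^ 3" by (simp add: eval_nat_numeral)
    also have "\<dots> \<le> q * (3 * S 2 + 3 * S 1 + S 0) * (1 - q) ^ 3" using S3 q by (intro mult_right_mono) auto
    also have "\<dots> = q * (3 * (S 2 * (1 - q) ^ 3) + 3 * ((S 1 * (1 - q)\<^sup>2) * (1 - q)) + (S 0 * (1 - q)) * (1 - q)\<^sup>2)"
      by (simp add: power2_eq_square power3_eq_cube algebra_simps)
    also have "\<dots> \<le> q * (3 * (q * (1 + q)) + 3 * (q * (1 - q)) + 1 * (1 - q)\<^sup>2)"
      using b1 b2 S0 q by (intro mult_left_mono add_mono mult_right_mono) auto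
    also have "\<dots> = q * (1 + 4 * q + q\<^sup>2)" by (simp add: power2_eq_square algebra_simps)
    finally show ?thesis .
  qed
  have "S 1 * E * q \<le> q" using b1 E_q by (simp add: mult.assoc)
  then have "S 1 * E \<le> 1" using q by simp
  then have "S 1 \<le> 1 / E" using E by (simp add: field_simps)
  also have "\<dots> \<le> 1 / s\<^sup>2" using E(1) pos(1) by (intro frac_le) auto
  finally show "(\<Sum>k\<le>M. real k * exp (- s) ^ k) \<le> 1 / s\<^sup>2" by (simp add: S_def q_def)

  have q4: "(E + 4) * q = (1 + q)\<^sup>2" using E_q by (simp add: power2_eq_square algebra_simps)
  have S_nonneg: "0 \<le> S j" for j using q by (simp add: S_def sum_nonneg)
  \<comment> \<open>The bound for j = 2 contains the odd power (1 - q)^3, which becomes a power of E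
    q only after squaring.\<close>
  have "(S 2)\<^sup>2 * E ^ 3 \<le> E + 4"
  proof -
    have "(S 2 * (1 - q) ^ 3)\<^sup>2 \<le> (q * (1 + q))\<^sup>2"
      using b2 S_nonneg q by (intro power_mono) auto
    moreover have "(S 2 * (1 - q) ^ 3)\<^sup>2 = (S 2)\<^sup>2 * (E * q) ^ 3"
      unfolding E_q by (simp add: power_mult_distrib flip: power_mult)
    moreover have "(q * (1 + q))\<^sup>2 = q\<^sup>2 * ((E + 4) * q)"
      unfolding q4 by (simp add: power_mult_distrib)
    ultimately have "(S 2)\<^sup>2 * (E * q) ^ 3 \<le> q\<^sup>2 * ((E + 4) * q)" by (simp only:)
    then have "((S 2)\<^sup>2 * E ^ 3) * q ^ 3 \<le> (E + 4) * q ^ 3"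
      by (simp add: power_mult_distrib power2_eq_square power3_eq_cube mult_ac)
    then show ?thesis using q by simp
  qed
  moreover have "s ^ 6 * (E + 4) \<le> 4 * E ^ 3"
  proof -
    define v where "v = s\<^sup>2 / 12"
    have v: "0 < v" "s\<^sup>2 = 12 * v" using pos by (auto simp: v_def)
    define D where "D = E / s\<^sup>2"
    have D: "E = s\<^sup>2 * D" using pos by (simp add: D_def)
    have "s\<^sup>2 * (1 + v) = s\<^sup>2 + s ^ 4 / 12"
      by (simp add: v_def power2_eq_square eval_nat_numeral algebra_simps)
    then have "s\<^sup>2 * (1 + v) \<le> E" using E_ge pos(3) by linarith
    then have D_ge: "1 + v \<le> D" using pos by (simp add: D_def field_simps)
    have sq: "(1 + v)\<^sup>2 \<le> D\<^sup>2" using D_ge v by (intro power_mono) auto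
    \<comment> \<open>The product is (1 + v)(1 - v + v^2) = 1 + v^3.\<close>
    have "1 \<le> (1 + v) * ((1 + v)\<^sup>2 - 3 * v)"
      using v by (simp add: power2_eq_square algebra_simps)
    also have "\<dots> \<le> D * (D\<^sup>2 - 3 * v)"
    proof (intro mult_mono)
      have "(1 + v)\<^sup>2 - 3 * v = (v - 1/2)\<^sup>2 + 3/4" by (simp add: power2_eq_square algebra_simps)
      then show "0 \<le> (1 + v)\<^sup>2 - 3 * v" by simp
    qed (use D_ge v sq in auto)
    finally have "s ^ 6 * 4 * 1 \<le> s ^ 6 * 4 * (D * (D\<^sup>2 - 3 * v))"
      using pos by (intro mult_left_mono) auto
    also have "\<dots> = 4 * E ^ 3 - s ^ 6 * E"
    proof -
      have "s ^ 6 * E = s ^ 6 * (12 * v) * D" unfolding D v(2) by simp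
      moreover have "E ^ 3 = s ^ 6 * D ^ 3" unfolding D by (simp add: power_mult_distrib flip: power_mult)
      ultimately show ?thesis by (simp add: power2_eq_square power3_eq_cube algebra_simps)
    qed
    finally show ?thesis by (simp add: algebra_simps)
  qed
  ultimately have "(S 2)\<^sup>2 * E ^ 3 * s ^ 6 \<le> 4 * E ^ 3"
    by (smt (verit) mult.commute mult_right_mono pos(3))
  then have "(S 2)\<^sup>2 * s ^ 6 \<le> 4"
    using E by (simp add: mult.assoc mult.left_commute)
  then have "(S 2 * s ^ 3)\<^sup>2 \<le> 2\<^sup>2"
    by (simp add: power_mult_distrib flip: power_mult)
  then have "S 2 * s ^ 3 \<le> 2" by (rule power2_le_imp_le) simp
  then show "(\<Sum>k\<le>M. real k ^ 2 * exp (- s) ^ k) \<le> 2 / s ^ 3"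
    using assms by (simp add: S_def q_def field_simps)

  have "S 3 * E\<^sup>2 \<le> E + 6"
  proof -
    have "(S 3 * E\<^sup>2) * q\<^sup>2 = S 3 * (E * q)\<^sup>2" by (simp add: power_mult_distrib)
    also have "\<dots> = S 3 * (1 - q) ^ 4" unfolding E_q by (simp flip: power_mult)
    also note b3
    also have "q * (1 + 4 * q + q\<^sup>2) = q * (E * q + 6 * q)"
      unfolding E_q by (simp add: power2_eq_square algebra_simps)
    also have "\<dots> = (E + 6) * q\<^sup>2" by (simp add: power2_eq_square algebra_simps)
    finally show ?thesis using q by simp
  qed
  moreover have "s ^ 4 * (E + 6) \<le> 25 / 4 * E\<^sup>2"
  proof -
    define v where "v = s\<^sup>2 / 12"
    have v: "0 < v" "s\<^sup>2 = 12 * v" using pos by (auto simp: v_def)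
    define D where "D = E / s\<^sup>2"
    have D: "E = s\<^sup>2 * D" using pos by (simp add: D_def)
    define D0 where "D0 = 1 + v + 2 / 5 * v\<^sup>2"
    have "s\<^sup>2 * D0 = s\<^sup>2 + s ^ 4 / 12 + s ^ 6 / 360"
      by (simp add: D0_def v_def power2_eq_square eval_nat_numeral algebra_simps)
    then have D_ge: "D0 \<le> D" using E_ge pos by (simp add: D_def field_simps)
    \<comment> \<open>After division by s^4, with E = 12 v D, the claim reads 12 v D + 6 \<le> 25/4
      D^2.\<close>
    have "6 \<le> D0 * (25 / 4 * D0 - 12 * v)"
    proof -
      have "D0 * (25 / 4 * D0 - 12 * v) - 6 = 1/4 + 1/2 * v - 3/4 * v\<^sup>2 + 1/5 * v ^ 3 + v ^ 4"
        by (simp add: D0_def power2_eq_square eval_nat_numeral algebra_simps)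
      also have "\<dots> = (v\<^sup>2 - 1/2)\<^sup>2 + 1/4 * v\<^sup>2 + 1/2 * v + 1/5 * v ^ 3"
        by (simp add: power2_eq_square eval_nat_numeral algebra_simps)
      also have "0 \<le> \<dots>" using v by simp
      finally show ?thesis by simp
    qed
    also have "\<dots> \<le> D * (25 / 4 * D - 12 * v)"
    proof (intro mult_mono)
      have "0 \<le> D0" using v by (simp add: D0_def)
      then show "0 \<le> D" using D_ge by simp
      have "25 / 4 * D0 - 12 * v = 5/2 * (v - 23/20)\<^sup>2 + (25/4 - 5/2 * (23/20)\<^sup>2)"
        by (simp add: D0_def power2_eq_square algebra_simps)
      also have "0 \<le> \<dots>" by (simp add: power2_eq_square)
      finally show "0 \<le> 25 / 4 * D0 - 12 * v" .
    qed (use D_ge in auto)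
    finally have "s ^ 4 * 6 \<le> s ^ 4 * (D * (25 / 4 * D - 12 * v))"
      using pos by (intro mult_left_mono) auto
    also have "\<dots> = 25 / 4 * E\<^sup>2 - s ^ 4 * E"
    proof -
      have "s ^ 4 * E = s ^ 4 * (12 * v) * D" unfolding D v(2) by simp
      moreover have "E\<^sup>2 = s ^ 4 * D\<^sup>2" unfolding D by (simp add: power_mult_distrib flip: power_mult)
      ultimately show ?thesis by (simp add: power2_eq_square algebra_simps)
    qed
    finally show ?thesis by (simp add: algebra_simps)
  qed
  ultimately have "S 3 * E\<^sup>2 * s ^ 4 \<le> 25 / 4 * E\<^sup>2"
    by (smt (verit) mult.commute mult_right_mono pos(2))
  then have "(S 3 * s ^ 4) * E\<^sup>2 \<le> 25 / 4 * E\<^sup>2" by (simp only: mult_ac)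
  then have "S 3 * s ^ 4 \<le> 25 / 4"
    using E by (simp only: mult_le_cancel_right) auto
  then show "(\<Sum>k\<le>M. real k ^ 3 * exp (- s) ^ k) \<le> 25 / 4 / s ^ 4"
    using assms by (simp add: S_def q_def field_simps)
qed

section \<open>Moments of the divisor series\<close>

definition log_coeff :: "nat \<Rightarrow> real" where
  "log_coeff N = real (divisor_sum N) / real N"

lemma log_coeff_nonneg: "0 \<le> log_coeff N"
  by (simp add: log_coeff_def)

lemma log_coeff_ge_1:
  assumes "0 < N" shows "1 \<le> log_coeff N"
proof -
  have "\<Sum>{N} \<le> \<Sum>{d. d dvd N}"
    using assms by (intro sum_mono2) (auto intro: finite_divisors_nat)
  then have "real N \<le> real (divisor_sum N)" by (simp only: divisor_sum_def of_nat_le_iff) simp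
  then show ?thesis using assms by (simp add: log_coeff_def)
qed

text \<open>Write N = m k, where k is the divisor counted by \<sigma>: the sum becomes the double
  sum of m^(j - 1) k^j x^(m k). The sum over k is at most c/(m t)^(j + 1), the powers of m combine
  to 1/m^2, and these add up to at most \<pi>^2/6.\<close>

lemma log_coeff_moment_partial:
  fixes t c :: real
  assumes t: "0 < t" and j: "0 < j"
    and c: "\<And>s M. 0 < s \<Longrightarrow> (\<Sum>k\<le>M. real k ^ j * exp (- s) ^ k) \<le> c / s ^ (j + 1)"
  shows "(\<Sum>N<M. real N ^ j * log_coeff N * exp (- t) ^ N) \<le> pi\<^sup>2 / 6 * c / t ^ (j + 1)"
proof -
  define x where "x = exp (- t)"
  have x: "0 < x" by (simp add: x_def)
  obtain i where i: "j = Suc i" using j gr0_implies_Suc by blast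
  have "0 \<le> (\<Sum>k\<le>0. real k ^ j * exp (- t) ^ k)" by (simp add: sum_nonneg)
  also have "\<dots> \<le> c / t ^ (j + 1)" using c[OF t] .
  finally have c0: "0 \<le> c" using t by (simp only: zero_le_divide_iff) (smt (verit) zero_less_power)
  have "(\<Sum>N<M. real N ^ j * log_coeff N * x ^ N) = (\<Sum>N\<in>{1..<M}. real N ^ j * log_coeff N * x ^ N)"
    by (intro sum.mono_neutral_right) (auto simp: log_coeff_def)
  also have "\<dots> = (\<Sum>N\<in>{1..<M}. \<Sum>d | d dvd N. real N ^ i * real d * x ^ N)"
  proof (intro sum.cong refl)
    fix N assume "N \<in> {1..<M}"
    then have "real N ^ j * log_coeff N * x ^ N = real N ^ i * real (divisor_sum N) * x ^ N"
      by (simp add: log_coeff_def i)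
    then show "real N ^ j * log_coeff N * x ^ N = (\<Sum>d | d dvd N. real N ^ i * real d * x ^ N)"
      by (simp add: divisor_sum_def sum_distrib_left sum_distrib_right)
  qed
  also have "\<dots> = (\<Sum>(N, d)\<in>Sigma {1..<M} (\<lambda>N. {d. d dvd N}). real N ^ i * real d * x ^ N)"
    by (intro sum.Sigma) (auto intro: finite_divisors_nat)
  also have "\<dots> \<le> (\<Sum>(m, k)\<in>{1..M} \<times> {..M}. real m ^ i * (real k ^ j * (x ^ m) ^ k))"
  proof (rule sum_le_included[where i = "\<lambda>(m, k). (m * k, k)"])
    show "\<forall>y\<in>Sigma {1..<M} (\<lambda>N. {d. d dvd N}). \<exists>z\<in>{1..M} \<times> {..M}.
       (case z of (m, k) \<Rightarrow> (m * k, k)) = y \<and>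
       (case y of (N, d) \<Rightarrow> real N ^ i * real d * x ^ N)
         \<le> (case z of (m, k) \<Rightarrow> real m ^ i * (real k ^ j * (x ^ m) ^ k))"
    proof
      fix y assume "y \<in> Sigma {1..<M} (\<lambda>N. {d. d dvd N})"
      then obtain N d where y: "y = (N, d)" "N \<in> {1..<M}" "d dvd N" by blast
      then obtain m where m: "N = m * d" by (metis dvdE mult.commute)
      have "m dvd N" using m by simp
      then have "m \<le> N" "d \<le> N" using y by (auto intro!: dvd_imp_le)
      moreover have "N \<le> M" "0 < m" using y m by (auto intro!: Nat.gr0I)
      ultimately have "m \<in> {1..M}" "d \<in> {..M}" by auto
      moreover have "real N ^ i * real d * x ^ N = real m ^ i * (real d ^ j * (x ^ m) ^ d)"
        by (simp add: m i power_mult power_mult_distrib)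
      ultimately show "\<exists>z\<in>{1..M} \<times> {..M}.
         (case z of (m, k) \<Rightarrow> (m * k, k)) = y \<and>
         (case y of (N, d) \<Rightarrow> real N ^ i * real d * x ^ N)
           \<le> (case z of (m, k) \<Rightarrow> real m ^ i * (real k ^ j * (x ^ m) ^ k))"
        using y m by (intro bexI[of _ "(m, d)"]) auto
    qed
  qed (use x in \<open>auto intro!: finite_SigmaI finite_divisors_nat\<close>)
  also have "\<dots> = (\<Sum>m\<in>{1..M}. real m ^ i * (\<Sum>k\<le>M. real k ^ j * (x ^ m) ^ k))"
    by (simp add: sum.cartesian_product[symmetric] sum_distrib_left)
  also have "\<dots> \<le> (\<Sum>m\<in>{1..M}. c / t ^ (j + 1) * (1 / real m ^ 2))"
  proof (rule sum_mono)
    fix m assume m: "m \<in> {1..M}"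
    have "(\<Sum>k\<le>M. real k ^ j * (x ^ m) ^ k) \<le> c / (real m * t) ^ (j + 1)"
      using c[of "real m * t" M] m t by (simp add: x_def exp_of_nat_mult[symmetric])
    then have "real m ^ i * (\<Sum>k\<le>M. real k ^ j * (x ^ m) ^ k) \<le> real m ^ i * (c / (real m * t) ^ (j + 1))"
      by (intro mult_left_mono) auto
    also have "\<dots> = c / t ^ (j + 1) * (1 / real m ^ 2)"
      using m by (simp add: i power_mult_distrib field_simps power2_eq_square)
    finally show "real m ^ i * (\<Sum>k\<le>M. real k ^ j * (x ^ m) ^ k) \<le> c / t ^ (j + 1) * (1 / real m ^ 2)" .
  qed
  also have "\<dots> = c / t ^ (j + 1) * (\<Sum>m\<in>{1..M}. 1 / real m ^ 2)"
    by (simp add: sum_distrib_left)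
  also have "\<dots> \<le> c / t ^ (j + 1) * (pi\<^sup>2 / 6)"
  proof (rule mult_left_mono)
    have "(\<Sum>m\<in>{1..M}. 1 / real m ^ 2) = (\<Sum>m<M. 1 / (real (Suc m))\<^sup>2)"
      by (rule sum.reindex_bij_witness[of _ Suc "\<lambda>m. m - 1"]) auto
    also have "\<dots> \<le> pi\<^sup>2 / 6"
      using inverse_squares_sums by (intro sum_le_suminf[THEN order_trans]) (auto simp: sums_iff add.commute)
    finally show "(\<Sum>m\<in>{1..M}. 1 / real m ^ 2) \<le> pi\<^sup>2 / 6" .
  qed (use c0 t in auto)
  finally show ?thesis by (simp add: x_def mult_ac)
qed

lemma log_coeff_moments:
  fixes t :: real
  assumes "0 < t"
  shows "summable (\<lambda>N. log_coeff N * exp (- t) ^ N)"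
    and "summable (\<lambda>N. real N * log_coeff N * exp (- t) ^ N)"
    and "summable (\<lambda>N. real N ^ 2 * log_coeff N * exp (- t) ^ N)"
    and "summable (\<lambda>N. real N ^ 3 * log_coeff N * exp (- t) ^ N)"
    and "(\<Sum>N. real N * log_coeff N * exp (- t) ^ N) \<le> pi\<^sup>2 / 6 / t\<^sup>2"
    and "(\<Sum>N. real N ^ 2 * log_coeff N * exp (- t) ^ N) \<le> pi\<^sup>2 / 6 * 2 / t ^ 3"
    and "(\<Sum>N. real N ^ 3 * log_coeff N * exp (- t) ^ N) \<le> pi\<^sup>2 / 6 * (25 / 4) / t ^ 4"
proof -
  have nonneg: "0 \<le> real N ^ j * log_coeff N * exp (- t) ^ N" for N j
    by (simp add: log_coeff_nonneg)
  have p1: "(\<Sum>N<M. real N ^ 1 * log_coeff N * exp (- t) ^ N) \<le> pi\<^sup>2 / 6 * 1 / t ^ (1 + 1)" for M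
    using assms exponential_moment_sums(1) by (intro log_coeff_moment_partial) (auto simp: power2_eq_square)
  have p2: "(\<Sum>N<M. real N ^ 2 * log_coeff N * exp (- t) ^ N) \<le> pi\<^sup>2 / 6 * 2 / t ^ (2 + 1)" for M
    using assms exponential_moment_sums(2) by (intro log_coeff_moment_partial) auto
  have p3: "(\<Sum>N<M. real N ^ 3 * log_coeff N * exp (- t) ^ N) \<le> pi\<^sup>2 / 6 * (25 / 4) / t ^ (3 + 1)" for M
    using assms exponential_moment_sums(3) by (intro log_coeff_moment_partial) auto
  have s1: "summable (\<lambda>N. real N ^ 1 * log_coeff N * exp (- t) ^ N)"
    using nonneg p1 by (rule summableI_nonneg_bounded)
  have s2: "summable (\<lambda>N. real N ^ 2 * log_coeff N * exp (- t) ^ N)"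
    using nonneg p2 by (rule summableI_nonneg_bounded)
  have s3: "summable (\<lambda>N. real N ^ 3 * log_coeff N * exp (- t) ^ N)"
    using nonneg p3 by (rule summableI_nonneg_bounded)
  show "summable (\<lambda>N. log_coeff N * exp (- t) ^ N)"
  proof (rule summable_comparison_test[OF _ s1], intro exI allI impI)
    fix N assume "1 \<le> (N :: nat)"
    then show "norm (log_coeff N * exp (- t) ^ N) \<le> real N ^ 1 * log_coeff N * exp (- t) ^ N"
      using log_coeff_nonneg[of N] by (simp add: mult_right_mono mult_le_cancel_right1)
  qed
  show "summable (\<lambda>N. real N * log_coeff N * exp (- t) ^ N)" using s1 by simp
  show "summable (\<lambda>N. real N ^ 2 * log_coeff N * exp (- t) ^ N)" by (rule s2)
  show "summable (\<lambda>N. real N ^ 3 * log_coeff N * exp (- t) ^ N)" by (rule s3)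
  show "(\<Sum>N. real N * log_coeff N * exp (- t) ^ N) \<le> pi\<^sup>2 / 6 / t\<^sup>2"
    using suminf_le_const[OF s1 p1] by (simp add: power2_eq_square)
  show "(\<Sum>N. real N ^ 2 * log_coeff N * exp (- t) ^ N) \<le> pi\<^sup>2 / 6 * 2 / t ^ 3"
    using suminf_le_const[OF s2 p2] by simp
  show "(\<Sum>N. real N ^ 3 * log_coeff N * exp (- t) ^ N) \<le> pi\<^sup>2 / 6 * (25 / 4) / t ^ 4"
    using suminf_le_const[OF s3 p3] by simp
qed

section \<open>The generating function and its Fourier coefficients\<close>

lemma log_coeff_summable_complex:
  fixes z :: complex
  assumes "norm z < 1"
  shows "summable (\<lambda>N. norm (of_real (log_coeff N) * z ^ N))"
proof (cases "z = 0")
  case True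
  have "summable (\<lambda>N. if N = 0 then log_coeff 0 else 0)" by (rule summable_single)
  moreover have "(\<lambda>N. norm (of_real (log_coeff N) * z ^ N)) = (\<lambda>N. if N = 0 then log_coeff 0 else 0)"
    by (auto simp: True log_coeff_nonneg)
  ultimately show ?thesis by simp
next
  case False
  then have "exp (- (- ln (norm z))) = norm z" "0 < - ln (norm z)"
    using assms by (auto simp: ln_less_zero)
  then have "summable (\<lambda>N. log_coeff N * norm z ^ N)"
    using log_coeff_moments(1)[of "- ln (norm z)"] by simp
  then show ?thesis by (simp add: norm_mult norm_power log_coeff_nonneg)
qed

definition log_gf :: "complex \<Rightarrow> complex" where
  "log_gf z = (\<Sum>N. of_real (log_coeff N) * z ^ N)"

lemma log_gf_sums:
  assumes "norm z < 1"
  shows "(\<lambda>N. of_real (log_coeff N) * z ^ N) sums log_gf z"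
  unfolding log_gf_def using summable_norm_cancel[OF log_coeff_summable_complex[OF assms]]
  by (rule summable_sums)

lemma log_gf_eval_fps:
  defines "g \<equiv> Abs_fps (\<lambda>N. complex_of_real (log_coeff N))"
  shows "log_gf = eval_fps g" and "1 \<le> fps_conv_radius g"
proof -
  show "log_gf = eval_fps g"
    by (auto simp: log_gf_def eval_fps_def g_def)
  show "1 \<le> fps_conv_radius g"
    unfolding fps_conv_radius_def
  proof (rule conv_radius_geI_ex)
    fix r :: real assume "0 < r" "ereal r < 1"
    then show "\<exists>z. norm z = r \<and> summable (\<lambda>n. fps_nth g n * z ^ n)"
      using summable_norm_cancel[OF log_coeff_summable_complex[of "of_real r"]]
      by (intro exI[of _ "of_real r"]) (auto simp: g_def one_ereal_def)
  qed
qed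

lemma holomorphic_log_gf: "log_gf holomorphic_on ball 0 1"
  unfolding log_gf_eval_fps(1)
  by (intro holomorphic_on_eval_fps) (auto simp: in_eball_iff intro!: less_le_trans[OF _ log_gf_eval_fps(2)])

text \<open>F = exp(\<open>log_gf\<close>) satisfies F' = F * \<open>deriv log_gf\<close>, so its
  Taylor coefficients obey the divisor sum recurrence with value 1 at 0 and must be p(n). The Taylor
  series converges on the whole disc because F is holomorphic there; no growth bound on p(n)
  enters.\<close>

lemma partition_gf_sums:
  fixes z :: complex
  assumes "norm z < 1"
  shows "(\<lambda>n. of_nat (partition_number n) * z ^ n) sums exp (log_gf z)"
proof -
  define g where "g = Abs_fps (\<lambda>N. complex_of_real (log_coeff N))"
  note log_gf = log_gf_eval_fps(1)[folded g_def]
  note rad = log_gf_eval_fps(2)[folded g_def]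
  define F where "F = (\<lambda>z. exp (log_gf z))"
  note hol = holomorphic_log_gf
  have hol_F: "F holomorphic_on ball 0 1"
    unfolding F_def using hol by (intro holomorphic_intros)
  define f where "f = fps_expansion F 0"
  have f: "F has_fps_expansion f"
    unfolding f_def using hol_F by (intro has_fps_expansion_fps_expansion[of "ball 0 1"]) auto
  have g: "log_gf has_fps_expansion g"
    using rad by (auto simp: has_fps_expansion_def log_gf intro: order.strict_trans2[of _ 1])
  have "deriv F has_fps_expansion f * fps_deriv g"
  proof (subst has_fps_expansion_cong[OF _ refl])
    show "(\<lambda>z. F z * deriv log_gf z) has_fps_expansion f * fps_deriv g"
      using f g by (intro has_fps_expansion_mult has_fps_expansion_deriv)
    show "\<forall>\<^sub>F z in nhds 0. deriv F z = F z * deriv log_gf z"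
    proof (rule eventually_mono[OF eventually_nhds_in_open[of "ball 0 1"]])
      fix z :: complex assume "z \<in> ball 0 1"
      then have "(log_gf has_field_derivative deriv log_gf z) (at z)"
        using hol by (intro holomorphic_derivI[of _ "ball 0 1"]) auto
      then show "deriv F z = F z * deriv log_gf z"
        unfolding F_def by (intro DERIV_imp_deriv) (auto intro!: derivative_eq_intros)
    qed auto
  qed
  then have f': "fps_deriv f = f * fps_deriv g"
    using fps_expansion_unique_complex has_fps_expansion_deriv[OF f] by blast
  have f0: "fps_nth f 0 = 1"
    by (simp add: f_def fps_expansion_def F_def log_gf eval_fps_at_0 g_def log_coeff_def)
  have g_nth: "of_nat k * fps_nth g k = of_nat (divisor_sum k)" if "0 < k" for k
    using that by (simp add: g_def log_coeff_def)
  have frec: "of_nat n * fps_nth f n = (\<Sum>k=1..n. of_nat (divisor_sum k) * fps_nth f (n - k))" for n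
  proof (cases n)
    case (Suc m)
    have "of_nat n * fps_nth f n = fps_nth (fps_deriv f) m" by (simp add: Suc)
    also have "\<dots> = (\<Sum>i=0..m. fps_nth f i * (of_nat (m - i + 1) * fps_nth g (m - i + 1)))"
      unfolding f' fps_mult_nth by simp
    also have "\<dots> = (\<Sum>i=0..m. fps_nth f i * of_nat (divisor_sum (m - i + 1)))"
      by (intro sum.cong refl arg_cong2[of _ _ _ _ "(*)"] g_nth) simp
    also have "\<dots> = (\<Sum>k=1..n. of_nat (divisor_sum k) * fps_nth f (n - k))"
      by (rule sum.reindex_bij_witness[of _ "\<lambda>k. n - k" "\<lambda>i. n - i"])
         (auto simp: Suc Suc_diff_le)
    finally show ?thesis .
  qed simp
  have fp: "fps_nth f n = of_nat (partition_number n)" for n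
  proof (induction n rule: less_induct)
    case (less n)
    show ?case
    proof (cases "n = 0")
      case False
      have "of_nat n * fps_nth f n = (\<Sum>k=1..n. of_nat (divisor_sum k) * of_nat (partition_number (n - k)))"
        unfolding frec using less.IH by (intro sum.cong) auto
      also have "\<dots> = of_nat n * of_nat (partition_number n)"
        unfolding of_nat_mult[symmetric] of_nat_sum[symmetric] partition_number_divisor_sum[symmetric] ..
      finally show ?thesis using False by simp
    qed (simp add: f0 partition_number_0)
  qed
  have "(\<lambda>n. (deriv ^^ n) F 0 / fact n * (z - 0) ^ n) sums F z"
    using assms hol_F by (intro holomorphic_power_series[of _ _ 1]) auto
  moreover have "(deriv ^^ n) F 0 / fact n = of_nat (partition_number n)" for n
    using fp[of n] by (simp add: f_def fps_expansion_def)
  ultimately have "(\<lambda>n. of_nat (partition_number n) * z ^ n) sums F z"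
    by (simp only: diff_zero)
  then show ?thesis unfolding F_def .
qed

lemma has_integral_cis:
  fixes j :: int
  shows "((\<lambda>\<theta>. cis (of_int j * \<theta>)) has_integral (if j = 0 then 2 * pi else 0)) {-pi..pi}"
proof (cases "j = 0")
  case True
  then show ?thesis using has_integral_const_real[of "1 :: complex" "-pi" pi] by (simp add: scaleR_conv_of_real)
next
  case False
  define F where "F = (\<lambda>\<theta>. cis (of_int j * \<theta>) / (\<i> * of_int j))"
  have cis_j: "cis (of_int j * \<theta>) = exp (\<i> * of_int j * of_real \<theta>)" for \<theta>
    by (simp add: cis_conv_exp mult_ac)
  have "((\<lambda>\<theta>. cis (of_int j * \<theta>)) has_integral (F pi - F (-pi))) {-pi..pi}"
  proof (rule fundamental_theorem_of_calculus)
    fix \<theta> :: real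
    have "((\<lambda>z. exp (\<i> * of_int j * z) / (\<i> * of_int j)) has_field_derivative exp (\<i> * of_int j * of_real \<theta>)) (at (of_real \<theta>))"
      using False by (auto intro!: derivative_eq_intros)
    then have "((\<lambda>\<theta>. exp (\<i> * of_int j * of_real \<theta>) / (\<i> * of_int j)) has_vector_derivative exp (\<i> * of_int j * of_real \<theta>)) (at \<theta> within {-pi..pi})"
      by (intro has_vector_derivative_real_field)
    then show "(F has_vector_derivative cis (of_int j * \<theta>)) (at \<theta> within {-pi..pi})"
      unfolding F_def cis_j .
  qed simp
  moreover have "F pi = F (-pi)"
  proof -
    have "sin (of_int j * pi) = 0" by (simp add: sin_zero_iff_int2)
    then show ?thesis by (simp add: F_def complex_eq_iff cis.ctr)
  qed
  ultimately show ?thesis using False by simp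
qed

lemma fourier_coefficient_partition_gf:
  fixes x :: real and m :: nat
  assumes "0 < x" "x < 1"
  shows "((\<lambda>\<theta>. exp (log_gf (of_real x * cis \<theta>)) * cis (- (of_nat m * \<theta>)))
           has_integral (2 * pi * partition_number m * x ^ m)) {-pi..pi}"
proof -
  define f where "f k \<theta> = of_nat (partition_number k) * (of_real x * cis \<theta>) ^ k * cis (- (of_nat m * \<theta>))" for k \<theta>
  define I where "I K = (\<Sum>k<K. complex_of_real (if k = m then 2 * pi * partition_number m * x ^ m else 0))" for K
  have "summable (\<lambda>k. partition_number k * x ^ k)"
  proof -
    have "summable (\<lambda>k. Re (of_nat (partition_number k) * of_real x ^ k))"
      using partition_gf_sums[of "of_real x"] assms by (intro summable_Re) (auto simp: sums_iff)
    then show ?thesis by (simp flip: of_real_power)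
  qed
  then have "uniform_limit {-pi..pi} (\<lambda>K \<theta>. \<Sum>k<K. f k \<theta>) (\<lambda>\<theta>. \<Sum>k. f k \<theta>) sequentially"
    using assms by (intro Weierstrass_m_test) (auto simp: f_def norm_mult norm_power)
  then obtain I' J where I': "\<And>K. ((\<lambda>\<theta>. \<Sum>k<K. f k \<theta>) has_integral I' K) {-pi..pi}"
    and J: "((\<lambda>\<theta>. \<Sum>k. f k \<theta>) has_integral J) {-pi..pi}" and lim: "I' \<longlonglongrightarrow> J"
    by (rule uniform_limit_integral) (auto simp: f_def intro!: continuous_intros)
  have fk: "(f k has_integral complex_of_real (if k = m then 2 * pi * partition_number m * x ^ m else 0)) {-pi..pi}" for k
  proof -
    have "f k = (\<lambda>\<theta>. of_real (partition_number k * x ^ k) * cis (of_int (int k - int m) * \<theta>))"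
      by (auto simp: f_def power_mult_distrib Complex.DeMoivre cis_mult algebra_simps)
    moreover have "((\<lambda>\<theta>. of_real (partition_number k * x ^ k) * cis (of_int (int k - int m) * \<theta>)) has_integral
        of_real (partition_number k * x ^ k) * (if int k - int m = 0 then 2 * pi else 0)) {-pi..pi}"
      using has_integral_mult_right[OF has_integral_cis[of "int k - int m"]] by simp
    ultimately show ?thesis by (auto simp: mult_ac)
  qed
  have "((\<lambda>\<theta>. \<Sum>k<K. f k \<theta>) has_integral I K) {-pi..pi}" for K
    unfolding I_def by (intro has_integral_sum fk) auto
  then have "I' = I" using I' has_integral_unique by blast
  moreover have "\<forall>\<^sub>F K in sequentially. I K = of_real (2 * pi * partition_number m * x ^ m)"
    using eventually_gt_at_top[of m] by eventually_elim (simp add: I_def if_distrib[of of_real] sum.delta cong: if_cong)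
  then have "I \<longlonglongrightarrow> of_real (2 * pi * partition_number m * x ^ m)"
    by (rule tendsto_eventually)
  ultimately have "J = of_real (2 * pi * partition_number m * x ^ m)"
    using lim LIMSEQ_unique by blast
  moreover have "(\<Sum>k. f k \<theta>) = exp (log_gf (of_real x * cis \<theta>)) * cis (- (of_nat m * \<theta>))" for \<theta>
    unfolding f_def using partition_gf_sums[of "of_real x * cis \<theta>"] assms
    by (intro sums_unique[symmetric] sums_mult2) (auto simp: norm_mult)
  ultimately show ?thesis using J by simp
qed

section \<open>Decay and phase on the circle\<close>

text \<open>With x = exp(-t) this is the real part of \<open>log_gf\<close> at x minus
  \<open>log_gf\<close> at x cis \<theta>: the logarithm of the factor by which the generating
  function shrinks in absolute value.\<close>

definition decay :: "real \<Rightarrow> real \<Rightarrow> real" where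
  "decay t \<theta> = (\<Sum>N. log_coeff N * exp (- t) ^ N * (1 - cos (real N * \<theta>)))"

text \<open>The imaginary part of \<open>log_gf\<close> on the circle, without its term linear in
  \<theta>; what remains is of third order at 0.\<close>

definition phase :: "real \<Rightarrow> real \<Rightarrow> real" where
  "phase t \<theta> = (\<Sum>N. log_coeff N * exp (- t) ^ N * (sin (real N * \<theta>) - real N * \<theta>))"

lemma one_minus_cos_le: "1 - cos u \<le> u\<^sup>2 / 2" for u :: real
proof -
  have "(sin (u / 2))\<^sup>2 \<le> (u / 2)\<^sup>2"
    using abs_sin_x_le_abs_x[of "u / 2"] by (rule abs_le_square_iff[THEN iffD1])
  moreover have "cos u = 1 - 2 * (sin (u / 2))\<^sup>2"
    using cos_double_sin[of "u / 2"] by simp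
  ultimately show ?thesis by (simp add: power_divide)
qed

lemma abs_sin_minus_self_le: "\<bar>sin u - u\<bar> \<le> \<bar>u\<bar> ^ 3 / 6" for u :: real
proof -
  have "(\<Sum>m<3. sin_coeff m * u ^ m) = u"
    by (simp add: eval_nat_numeral sin_coeff_def)
  then show ?thesis
    using Maclaurin_sin_bound[of u 3] by (simp add: eval_nat_numeral)
qed

lemma one_minus_cos_ge:
  fixes u :: real
  assumes "0 \<le> u" "u \<le> 1"
  shows "u\<^sup>2 / 2 * (1 - u\<^sup>2 / 12) \<le> 1 - cos u"
proof -
  define v where "v = u / 2"
  have v: "0 \<le> v" "v \<le> 1" using assms by (auto simp: v_def)
  then have "v\<^sup>2 \<le> 1" by (simp add: power_le_one)
  have "v - v ^ 3 / 6 \<le> sin v"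
    using abs_le_D2[OF abs_sin_minus_self_le[of v]] v(1) by (simp only: abs_of_nonneg)
  moreover have "v - v ^ 3 / 6 = v * (1 - v\<^sup>2 / 6)" by (simp add: power2_eq_square power3_eq_cube algebra_simps)
  moreover have "0 \<le> v * (1 - v\<^sup>2 / 6)" using v \<open>v\<^sup>2 \<le> 1\<close> by simp
  ultimately have "(v * (1 - v\<^sup>2 / 6))\<^sup>2 \<le> (sin v)\<^sup>2"
    by (intro power_mono) auto
  moreover have "(v * (1 - v\<^sup>2 / 6))\<^sup>2 = v\<^sup>2 * (1 - v\<^sup>2 / 3) + v\<^sup>2 * (v\<^sup>2 / 6)\<^sup>2"
    by (simp add: power2_eq_square algebra_simps)
  ultimately have "v\<^sup>2 * (1 - v\<^sup>2 / 3) \<le> (sin v)\<^sup>2"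
    by (smt (verit) mult_nonneg_nonneg zero_le_power2)
  moreover have "1 - cos u = 2 * (sin v)\<^sup>2"
    using cos_double_sin[of v] by (simp add: v_def)
  ultimately show ?thesis by (simp add: v_def power_divide)
qed

context
  fixes t :: real
  assumes t: "0 < t"
begin

private lemma summable_log_coeff_mult:
  assumes "\<And>N. \<bar>b N\<bar> \<le> C * real N ^ j" "j \<in> {2, 3 :: nat}"
  shows "summable (\<lambda>N. log_coeff N * exp (- t) ^ N * b N)"
    and "\<bar>\<Sum>N. log_coeff N * exp (- t) ^ N * b N\<bar> \<le> C * (\<Sum>N. real N ^ j * log_coeff N * exp (- t) ^ N)"
proof -
  have s: "summable (\<lambda>N. C * (real N ^ j * log_coeff N * exp (- t) ^ N))"
    using assms(2) log_coeff_moments(3,4)[OF t] by (intro summable_mult) auto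
  have le: "norm (log_coeff N * exp (- t) ^ N * b N) \<le> C * (real N ^ j * log_coeff N * exp (- t) ^ N)" for N
  proof -
    have "log_coeff N * exp (- t) ^ N * \<bar>b N\<bar> \<le> log_coeff N * exp (- t) ^ N * (C * real N ^ j)"
      using assms(1)[of N] log_coeff_nonneg[of N] by (intro mult_left_mono) auto
    then show ?thesis using log_coeff_nonneg[of N] by (simp add: abs_mult mult_ac)
  qed
  show "summable (\<lambda>N. log_coeff N * exp (- t) ^ N * b N)"
    using s le by (intro summable_comparison_test[OF _ s]) auto
  have "\<bar>\<Sum>N. log_coeff N * exp (- t) ^ N * b N\<bar> \<le> (\<Sum>N. C * (real N ^ j * log_coeff N * exp (- t) ^ N))"
    using norm_suminf_le[OF le s] by simp
  also have "\<dots> = C * (\<Sum>N. real N ^ j * log_coeff N * exp (- t) ^ N)"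
    using assms(2) log_coeff_moments(3,4)[OF t] by (intro suminf_mult) auto
  finally show "\<bar>\<Sum>N. log_coeff N * exp (- t) ^ N * b N\<bar> \<le> C * (\<Sum>N. real N ^ j * log_coeff N * exp (- t) ^ N)" .
qed

private lemma decay_term_bound: "\<bar>1 - cos (real N * \<theta>)\<bar> \<le> \<theta>\<^sup>2 / 2 * real N ^ 2"
  using one_minus_cos_le[of "real N * \<theta>"] by (simp add: power_mult_distrib mult.commute)

private lemma phase_term_bound: "\<bar>sin (real N * \<theta>) - real N * \<theta>\<bar> \<le> \<bar>\<theta>\<bar> ^ 3 / 6 * real N ^ 3"
  using abs_sin_minus_self_le[of "real N * \<theta>"] by (simp add: abs_mult power_mult_distrib mult.commute)

lemma summable_decay: "summable (\<lambda>N. log_coeff N * exp (- t) ^ N * (1 - cos (real N * \<theta>)))"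
  using decay_term_bound by (rule summable_log_coeff_mult) simp

lemma summable_phase: "summable (\<lambda>N. log_coeff N * exp (- t) ^ N * (sin (real N * \<theta>) - real N * \<theta>))"
  using phase_term_bound by (rule summable_log_coeff_mult) simp

lemma decay_le: "decay t \<theta> \<le> pi\<^sup>2 / 6 * \<theta>\<^sup>2 / t ^ 3"
proof -
  have "\<bar>decay t \<theta>\<bar> \<le> \<theta>\<^sup>2 / 2 * (\<Sum>N. real N ^ 2 * log_coeff N * exp (- t) ^ N)"
    unfolding decay_def using decay_term_bound by (rule summable_log_coeff_mult) simp
  also have "\<dots> \<le> \<theta>\<^sup>2 / 2 * (pi\<^sup>2 / 6 * 2 / t ^ 3)"
    by (intro mult_left_mono log_coeff_moments t) auto
  finally show ?thesis by (simp add: mult_ac)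
qed

lemma abs_phase_le: "\<bar>phase t \<theta>\<bar> \<le> 25 / 24 * (pi\<^sup>2 / 6) * \<bar>\<theta>\<bar> ^ 3 / t ^ 4"
proof -
  have "\<bar>phase t \<theta>\<bar> \<le> \<bar>\<theta>\<bar> ^ 3 / 6 * (\<Sum>N. real N ^ 3 * log_coeff N * exp (- t) ^ N)"
    unfolding phase_def using phase_term_bound by (rule summable_log_coeff_mult) simp
  also have "\<dots> \<le> \<bar>\<theta>\<bar> ^ 3 / 6 * (pi\<^sup>2 / 6 * (25 / 4) / t ^ 4)"
    by (intro mult_left_mono log_coeff_moments t) auto
  finally show ?thesis by (simp add: mult_ac)
qed

text \<open>The hypothesis is the saddle point condition: it makes the factor exp(-i n \<theta>)
  cancel exactly the linear term of the imaginary part.\<close>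

lemma exp_log_gf_polar:
  assumes n: "(\<Sum>N. real N * log_coeff N * exp (- t) ^ N) = real n"
  shows "exp (log_gf (of_real (exp (- t)) * cis \<theta>)) * cis (- (of_nat n * \<theta>))
    = exp (log_gf (of_real (exp (- t)))) * (of_real (exp (- decay t \<theta>)) * cis (phase t \<theta>))"
proof -
  define x where "x = exp (- t)"
  have x: "0 < x" "x < 1" using t by (auto simp: x_def)
  have "(\<lambda>N. of_real (log_coeff N) * (of_real x * cis \<theta>) ^ N - of_real (log_coeff N) * of_real x ^ N
          - \<i> * \<theta> * of_real (real N * log_coeff N * x ^ N))
      sums (log_gf (of_real x * cis \<theta>) - log_gf (of_real x) - \<i> * \<theta> * of_real (real n))"
  proof (intro sums_diff sums_mult log_gf_sums sums_of_real)
    show "(\<lambda>N. real N * log_coeff N * x ^ N) sums real n"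
      using n log_coeff_moments(2)[OF t] by (simp add: sums_iff x_def)
  qed (use x in \<open>auto simp: norm_mult\<close>)
  moreover have "of_real (log_coeff N) * (of_real x * cis \<theta>) ^ N - of_real (log_coeff N) * of_real x ^ N
          - \<i> * \<theta> * of_real (real N * log_coeff N * x ^ N)
      = Complex (- (log_coeff N * x ^ N * (1 - cos (real N * \<theta>)))) (log_coeff N * x ^ N * (sin (real N * \<theta>) - real N * \<theta>))" for N
    by (simp add: power_mult_distrib Complex.DeMoivre complex_eq_iff algebra_simps flip: of_real_power)
  ultimately have "(\<lambda>N. Complex (- (log_coeff N * x ^ N * (1 - cos (real N * \<theta>)))) (log_coeff N * x ^ N * (sin (real N * \<theta>) - real N * \<theta>)))
      sums (log_gf (of_real x * cis \<theta>) - log_gf (of_real x) - \<i> * \<theta> * of_real (real n))" by simp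
  moreover have "(\<lambda>N. Complex (- (log_coeff N * x ^ N * (1 - cos (real N * \<theta>)))) (log_coeff N * x ^ N * (sin (real N * \<theta>) - real N * \<theta>)))
      sums Complex (- decay t \<theta>) (phase t \<theta>)"
    unfolding decay_def phase_def x_def
    using summable_decay summable_phase
    by (auto simp: sums_complex_iff intro!: sums_minus summable_sums)
  ultimately have "log_gf (of_real x * cis \<theta>) - log_gf (of_real x) - \<i> * \<theta> * of_real (real n)
      = Complex (- decay t \<theta>) (phase t \<theta>)" using sums_unique2 by blast
  then have "log_gf (of_real x * cis \<theta>) + - (\<i> * \<theta> * of_nat n) = log_gf (of_real x) + Complex (- decay t \<theta>) (phase t \<theta>)"
    by (simp add: algebra_simps)
  then have "exp (log_gf (of_real x * cis \<theta>)) * exp (- (\<i> * \<theta> * of_nat n)) = exp (log_gf (of_real x)) * exp (Complex (- decay t \<theta>) (phase t \<theta>))"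
    by (simp only: exp_add[symmetric])
  moreover have "exp (- (\<i> * \<theta> * of_nat n)) = cis (- (of_nat n * \<theta>))"
    by (simp add: cis_conv_exp mult_ac)
  moreover have "exp (Complex (- decay t \<theta>) (phase t \<theta>)) = of_real (exp (- decay t \<theta>)) * cis (phase t \<theta>)"
    by (subst exp_eq_polar) simp
  ultimately show ?thesis unfolding x_def by (simp only:)
qed

text \<open>Only the part \<open>1 \<le> \<sigma>(N)/N\<close> of the coefficients is used, which makes the series geometric.\<close>
lemma decay_ge_geometric:
  "exp (- t) * (1 + exp (- t)) * (1 - cos \<theta>) / ((1 - exp (- t)) * ((1 - exp (- t))\<^sup>2 + 2 * exp (- t) * (1 - cos \<theta>)))
    \<le> decay t \<theta>"
proof -
  define x where "x = exp (- t)"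
  have x: "0 < x" "x < 1" using t by (auto simp: x_def)
  define z where "z = of_real x * cis \<theta>"
  define c where "c = 1 - cos \<theta>"
  define Q where "Q = (1 - x)\<^sup>2 + 2 * x * c"
  have c: "0 \<le> c" by (simp add: c_def)
  have Q: "0 < Q" unfolding Q_def using x c by (intro add_pos_nonneg) auto
  have "(\<lambda>N. x ^ N - Re (z ^ N)) sums (1 / (1 - x) - Re (1 / (1 - z)))"
    using x by (intro sums_diff geometric_sums sums_Re) (auto simp: z_def norm_mult)
  moreover have "x ^ N - Re (z ^ N) = x ^ N * (1 - cos (real N * \<theta>))" for N
    by (simp add: z_def power_mult_distrib Complex.DeMoivre algebra_simps flip: of_real_power)
  ultimately have geo: "(\<lambda>N. x ^ N * (1 - cos (real N * \<theta>))) sums (1 / (1 - x) - Re (1 / (1 - z)))" by simp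
  have "Re (1 / (1 - z)) = (1 - x * cos \<theta>) / ((1 - x * cos \<theta>)\<^sup>2 + (x * sin \<theta>)\<^sup>2)"
    by (simp add: Re_divide z_def)
  also have "(1 - x * cos \<theta>)\<^sup>2 + (x * sin \<theta>)\<^sup>2 = Q"
  proof -
    have "(1 - x * cos \<theta>)\<^sup>2 + (x * sin \<theta>)\<^sup>2 = 1 - 2 * x * cos \<theta> + x\<^sup>2 * ((sin \<theta>)\<^sup>2 + (cos \<theta>)\<^sup>2)"
      by algebra
    also have "\<dots> = Q" by (simp add: Q_def c_def power2_eq_square algebra_simps)
    finally show ?thesis .
  qed
  also have "1 - x * cos \<theta> = 1 - x + x * c" by (simp add: c_def algebra_simps)
  finally have "1 / (1 - x) - Re (1 / (1 - z)) = (Q - (1 - x) * (1 - x + x * c)) / ((1 - x) * Q)"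
    using x Q by (simp add: diff_divide_eq_iff divide_diff_eq_iff mult_ac)
  also have "Q - (1 - x) * (1 - x + x * c) = x * (1 + x) * c"
    by (simp add: Q_def power2_eq_square algebra_simps)
  finally have "x * (1 + x) * c / ((1 - x) * Q) = (\<Sum>N. x ^ N * (1 - cos (real N * \<theta>)))"
    using geo by (simp add: sums_iff)
  also have "\<dots> \<le> decay t \<theta>"
    unfolding decay_def
  proof (rule suminf_le)
    fix N :: nat
    show "x ^ N * (1 - cos (real N * \<theta>)) \<le> log_coeff N * exp (- t) ^ N * (1 - cos (real N * \<theta>))"
    proof (cases "N = 0")
      case False
      then have "1 * x ^ N \<le> log_coeff N * x ^ N"
        using log_coeff_ge_1[of N] x by (intro mult_right_mono) auto
      then show ?thesis unfolding x_def by (intro mult_right_mono) auto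
    qed simp
  qed (use geo summable_decay in \<open>auto simp: sums_iff\<close>)
  finally show ?thesis unfolding x_def c_def Q_def .
qed

text \<open>With E = 4 sinh(t/2)^2 and S = 2 (1 - cos \<theta>)/E the geometric bound equals (1/2)
  coth(t/2) S/(1 + S). It is increasing in S, S \<ge> s because 1 - cos increases on [0, \<pi>], and
  coth(t/2) is close to 2/t. The factors 995/1000 and 999/1000 absorb the corrections for t \<le>
  43/1000 and a t \<le> 172/1000.\<close>

lemma decay_ge:
  assumes t_le: "t \<le> 43 / 1000" and a: "0 \<le> a" "a \<le> 4" and \<theta>: "a * t \<le> \<bar>\<theta>\<bar>" "\<bar>\<theta>\<bar> \<le> pi"
  defines "s \<equiv> 995 / 1000 * a\<^sup>2"
  shows "999 / 1000 / t * (s / (1 + s)) \<le> decay t \<theta>"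
proof -
  define x where "x = exp (- t)"
  have x: "0 < x" "x < 1" using t by (auto simp: x_def)
  define E where "E = exp t + exp (- t) - 2"
  have Ex: "E * x = (1 - x)\<^sup>2"
    by (simp add: E_def x_def power2_eq_square algebra_simps flip: exp_add)
  have E_le: "E \<le> 2001 / 2000 * t\<^sup>2"
    unfolding E_def using t t_le by (intro exp_plus_exp_minus_le) auto
  have E: "0 < E"
  proof -
    have "0 < E * x" unfolding Ex using x by simp
    then show ?thesis using x by (simp add: zero_less_mult_iff)
  qed
  define c where "c = 1 - cos \<theta>"
  define S where "S = 2 * c / E"
  have c0: "0 \<le> c" by (simp add: c_def)
  then have S: "0 \<le> S" using E by (simp add: S_def)
  have at: "0 \<le> a * t" "a * t \<le> 172 / 1000"
    using a t t_le mult_mono[of a 4 t "43 / 1000"] by auto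
  have s: "0 \<le> s" by (simp add: s_def)
  have "s \<le> S"
  proof -
    have "cos \<bar>\<theta>\<bar> \<le> cos (a * t)"
      using at \<theta> by (intro cos_monotone_0_pi_le) auto
    then have "1 - cos (a * t) \<le> c" by (simp add: c_def)
    moreover have "(a * t)\<^sup>2 / 2 * (1 - (a * t)\<^sup>2 / 12) \<le> 1 - cos (a * t)"
      using at by (intro one_minus_cos_ge) auto
    moreover have "(a * t)\<^sup>2 / 2 * (997 / 1000) \<le> (a * t)\<^sup>2 / 2 * (1 - (a * t)\<^sup>2 / 12)"
    proof -
      have "(a * t)\<^sup>2 \<le> (172 / 1000)\<^sup>2" using at by (intro power_mono) auto
      also have "\<dots> \<le> 36 / 1000" by (simp add: power2_eq_square)
      finally have "997 / 1000 \<le> 1 - (a * t)\<^sup>2 / 12" by linarith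
      then show ?thesis by (intro mult_left_mono) auto
    qed
    ultimately have "(a * t)\<^sup>2 / 2 * (997 / 1000) \<le> c" by linarith
    then have c_ge: "997 / 1000 * a\<^sup>2 * t\<^sup>2 \<le> 2 * c" by (simp add: power_mult_distrib mult_ac)
    have "s * E \<le> s * (2001 / 2000 * t\<^sup>2)" using E_le s by (intro mult_left_mono) auto
    also have "\<dots> = (995 / 1000 * (2001 / 2000)) * (a\<^sup>2 * t\<^sup>2)" by (simp add: s_def)
    also have "\<dots> \<le> 997 / 1000 * (a\<^sup>2 * t\<^sup>2)" by (intro mult_right_mono) auto
    also have "\<dots> \<le> 2 * c" using c_ge by simp
    finally show ?thesis using E by (simp add: S_def field_simps)
  qed
  then have "s / (1 + s) \<le> S / (1 + S)"
    using s S by (simp add: divide_le_eq le_divide_eq algebra_simps add_pos_nonneg)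
  moreover have "2 * (999 / 1000) / t \<le> (1 + x) / (1 - x)"
  proof (rule power2_le_imp_le)
    have "(1 + x)\<^sup>2 = (1 - x)\<^sup>2 + 4 * x" by (simp add: power2_eq_square algebra_simps)
    then have "(1 + x)\<^sup>2 * E = (E + 4) * (1 - x)\<^sup>2"
      using Ex by (simp add: algebra_simps)
    then have "((1 + x) / (1 - x))\<^sup>2 = (E + 4) / E"
      using x E by (simp add: power_divide field_simps)
    moreover have "(2 * (999 / 1000) / t)\<^sup>2 \<le> 4 / E"
    proof -
      have "(2 * (999 / 1000))\<^sup>2 * E \<le> (2 * (999 / 1000))\<^sup>2 * (2001 / 2000 * t\<^sup>2)"
        using E_le by (intro mult_left_mono) auto
      also have "\<dots> \<le> 4 * t\<^sup>2" using zero_le_power2[of t] by (simp add: power2_eq_square)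
      finally show ?thesis using E t by (simp add: power_divide field_simps)
    qed
    moreover have "4 / E \<le> (E + 4) / E" using E by (intro divide_right_mono) auto
    ultimately show "(2 * (999 / 1000) / t)\<^sup>2 \<le> ((1 + x) / (1 - x))\<^sup>2" by linarith
  qed (use x in auto)
  ultimately have "2 * (999 / 1000) / t * (s / (1 + s)) \<le> (1 + x) / (1 - x) * (S / (1 + S))"
    using s x by (intro mult_mono) auto
  also have "\<dots> = 2 * (x * (1 + x) * c / ((1 - x) * ((1 - x)\<^sup>2 + 2 * x * c)))"
  proof -
    have "S / (1 + S) = 2 * c / (E + 2 * c)"
      using E S c0 by (simp add: S_def field_simps add_pos_nonneg)
    also have "\<dots> = 2 * c * x / (E * x + 2 * c * x)"
      using x by (simp flip: distrib_right)
    finally have "S / (1 + S) = 2 * c * x / ((1 - x)\<^sup>2 + 2 * x * c)"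
      unfolding Ex by (simp add: mult_ac)
    then show ?thesis by (simp add: mult_ac)
  qed
  also have "\<dots> \<le> 2 * decay t \<theta>"
    using decay_ge_geometric[of \<theta>] unfolding x_def c_def by simp
  finally have "2 * (999 / 1000 / t * (s / (1 + s))) \<le> 2 * decay t \<theta>" by simp
  then show ?thesis by (simp only: mult_le_cancel_left_pos zero_less_numeral)
qed

end

text \<open>The exponents come from the lower bound for the decay at \<open>|\<theta>| = t/2\<close>, \<open>t\<close> and \<open>4t\<close>.\<close>
definition arc_bound :: "real \<Rightarrow> real \<Rightarrow> real" where
  "arc_bound t \<theta> = (if \<theta> \<in> {-t..t} then exp (- (198 / 1000 / t)) else 0)
     + (if \<theta> \<in> {-4 * t..4 * t} then exp (- (497 / 1000 / t)) else 0) + exp (- (93 / 100 / t))"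

text \<open>Here s \<le> 1/4 in \<open>decay_ge\<close>, so s/(1 + s) \<ge> 4/5 s, and the constants
  multiply to about 0.795. With the rate lowered to \<pi>/4 the Gaussian integral is exactly 2
  t^(3/2).\<close>

lemma decay_ge_gaussian:
  assumes "0 < t" "t \<le> 43 / 1000" "\<bar>\<theta>\<bar> \<le> t / 2"
  shows "pi / 4 * \<theta>\<^sup>2 / t ^ 3 \<le> decay t \<theta>"
proof -
  define a where "a = \<bar>\<theta>\<bar> / t"
  have a: "0 \<le> a" "a \<le> 1 / 2" "\<theta>\<^sup>2 = a\<^sup>2 * t\<^sup>2"
    using assms by (auto simp: a_def field_simps power_divide)
  have sq: "a\<^sup>2 \<le> (1 / 2)\<^sup>2" using a by (intro power_mono) auto
  define s where "s = 995 / 1000 * a\<^sup>2"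
  have "s * (4 / 5) \<le> s / (1 + s)"
  proof -
    have "0 \<le> s" "s \<le> 1 / 4" using sq by (auto simp: s_def power2_eq_square)
    then have "s * (4 / 5) * (1 + s) \<le> s * (4 / 5) * (5 / 4)" by (intro mult_left_mono) auto
    then show ?thesis using \<open>0 \<le> s\<close> by (simp add: le_divide_eq)
  qed
  then have "999 / 1000 / t * (s * (4 / 5)) \<le> 999 / 1000 / t * (s / (1 + s))"
    using assms by (intro mult_left_mono) auto
  also have "\<dots> \<le> decay t \<theta>"
  proof -
    have "a * t = \<bar>\<theta>\<bar>" using assms by (simp add: a_def)
    then show ?thesis
      unfolding s_def using assms a pi_gt3 by (intro decay_ge) auto
  qed
  finally have "999 / 1000 * (995 / 1000) * (4 / 5) * (a\<^sup>2 / t) \<le> decay t \<theta>"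
    by (simp add: s_def mult_ac)
  moreover have "pi / 4 * (a\<^sup>2 / t) \<le> 999 / 1000 * (995 / 1000) * (4 / 5) * (a\<^sup>2 / t)"
    using pi_less_4 pi_approx assms by (intro mult_right_mono) auto
  moreover have "pi / 4 * \<theta>\<^sup>2 / t ^ 3 = pi / 4 * (a\<^sup>2 / t)"
    unfolding a(3) using assms by (simp add: power2_eq_square power3_eq_cube)
  ultimately show ?thesis by linarith
qed

lemma exp_decay_le_arc_bound:
  assumes "0 < t" "t \<le> 43 / 1000" "\<bar>\<theta>\<bar> \<le> pi" "t / 2 \<le> \<bar>\<theta>\<bar>"
  shows "exp (- decay t \<theta>) \<le> arc_bound t \<theta>"
proof -
  have step: "exp (- decay t \<theta>) \<le> exp (- (q / t))"
    if "0 \<le> a" "a \<le> 4" "a * t \<le> \<bar>\<theta>\<bar>" "q \<le> 999 / 1000 * (995 / 1000 * a\<^sup>2 / (1 + 995 / 1000 * a\<^sup>2))" for a q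
  proof -
    define r where "r = 995 / 1000 * a\<^sup>2 / (1 + 995 / 1000 * a\<^sup>2)"
    have "q / t \<le> 999 / 1000 * r / t"
      using that(4) assms(1) by (intro divide_right_mono) (auto simp: r_def)
    then have "q / t \<le> 999 / 1000 / t * (995 / 1000 * a\<^sup>2 / (1 + 995 / 1000 * a\<^sup>2))"
      unfolding r_def[symmetric] by simp
    also have "\<dots> \<le> decay t \<theta>" using that assms by (intro decay_ge) auto
    finally show ?thesis by simp
  qed
  consider "\<bar>\<theta>\<bar> \<le> t" | "t \<le> \<bar>\<theta>\<bar>" "\<bar>\<theta>\<bar> \<le> 4 * t" | "4 * t \<le> \<bar>\<theta>\<bar>" by linarith
  then show ?thesis
  proof cases
    case 1
    have "exp (- decay t \<theta>) \<le> exp (- (198 / 1000 / t))"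
      using assms by (intro step[of "1 / 2"]) (auto simp: power2_eq_square)
    then show ?thesis using 1 by (auto simp: arc_bound_def abs_le_iff add_increasing2)
  next
    case 2
    have "exp (- decay t \<theta>) \<le> exp (- (497 / 1000 / t))"
      using 2 by (intro step[of 1]) auto
    then show ?thesis using 2 by (auto simp: arc_bound_def abs_le_iff add_increasing add_increasing2)
  next
    case 3
    have "exp (- decay t \<theta>) \<le> exp (- (93 / 100 / t))"
      using 3 by (intro step[of 4]) auto
    then show ?thesis by (auto simp: arc_bound_def add_increasing)
  qed
qed

lemma arc_bound_nonneg: "0 \<le> arc_bound t \<theta>"
  by (simp add: arc_bound_def)

text \<open>A sum in place of a case distinction: the two parts can be integrated separately, the
  Gaussian over the whole line.\<close>

lemma exp_decay_le:
  assumes "0 < t" "t \<le> 43 / 1000" "\<bar>\<theta>\<bar> \<le> pi"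
  shows "exp (- decay t \<theta>) \<le> exp (- (pi / 4 / t ^ 3 * \<theta>\<^sup>2)) + arc_bound t \<theta>"
proof (cases "\<bar>\<theta>\<bar> \<le> t / 2")
  case True
  then show ?thesis
    using decay_ge_gaussian[of t \<theta>] assms arc_bound_nonneg[of t \<theta>] by (intro add_increasing2) auto
next
  case False
  then show ?thesis
    using exp_decay_le_arc_bound[of t \<theta>] assms by (intro add_increasing) auto
qed

text \<open>The factor \<open>1 - 16 \<theta>^4/t^4\<close> is nonpositive for \<open>|\<theta>| \<ge> t/2\<close>; it allows the integral to be
  extended to the whole line.\<close>
lemma exp_decay_cos_phase_ge:
  assumes t: "0 < t" "t \<le> 43 / 1000" and \<theta>: "\<bar>\<theta>\<bar> \<le> pi"
  shows "exp (- (pi\<^sup>2 / 6 / t ^ 3 * \<theta>\<^sup>2)) * (1 - 16 * \<theta> ^ 4 / t ^ 4)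
           - (25 / 24 * (pi\<^sup>2 / 6))\<^sup>2 / 2 * \<theta> ^ 6 / t ^ 8 * exp (- (pi / 4 / t ^ 3 * \<theta>\<^sup>2)) - arc_bound t \<theta>
    \<le> exp (- decay t \<theta>) * cos (phase t \<theta>)"
proof (cases "\<bar>\<theta>\<bar> \<le> t / 2")
  case True
  have "exp (- (pi\<^sup>2 / 6 / t ^ 3 * \<theta>\<^sup>2)) * (1 - 16 * \<theta> ^ 4 / t ^ 4) \<le> exp (- (pi\<^sup>2 / 6 / t ^ 3 * \<theta>\<^sup>2)) * 1"
    using t by (intro mult_left_mono) auto
  also have "\<dots> \<le> exp (- decay t \<theta>)"
    using decay_le[of t \<theta>] t by (simp add: mult_ac)
  finally have 1: "exp (- (pi\<^sup>2 / 6 / t ^ 3 * \<theta>\<^sup>2)) * (1 - 16 * \<theta> ^ 4 / t ^ 4) \<le> exp (- decay t \<theta>)" .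
  \<comment> \<open>As cos u \<ge> 1 - u^2/2, the phase costs half its square; the cubic bound on
    the phase yields the \<theta>^6/t^8 term.\<close>
  have "(phase t \<theta>)\<^sup>2 \<le> (25 / 24 * (pi\<^sup>2 / 6) * \<bar>\<theta>\<bar> ^ 3 / t ^ 4)\<^sup>2"
    using abs_phase_le[of t \<theta>] t by (intro power2_le_iff_abs_le[THEN iffD2]) auto
  also have "\<dots> = (25 / 24 * (pi\<^sup>2 / 6))\<^sup>2 * \<theta> ^ 6 / t ^ 8"
    by (simp add: power_mult_distrib power_divide flip: power_mult)
  finally have ph: "(phase t \<theta>)\<^sup>2 / 2 \<le> (25 / 24 * (pi\<^sup>2 / 6))\<^sup>2 / 2 * \<theta> ^ 6 / t ^ 8" by simp
  have "exp (- decay t \<theta>) - exp (- decay t \<theta>) * cos (phase t \<theta>) \<le> exp (- decay t \<theta>) * ((phase t \<theta>)\<^sup>2 / 2)"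
    using mult_left_mono[OF one_minus_cos_le[of "phase t \<theta>"], of "exp (- decay t \<theta>)"]
    by (simp add: right_diff_distrib)
  also have "\<dots> \<le> exp (- (pi / 4 / t ^ 3 * \<theta>\<^sup>2)) * ((25 / 24 * (pi\<^sup>2 / 6))\<^sup>2 / 2 * \<theta> ^ 6 / t ^ 8)"
    using ph decay_ge_gaussian[OF t True] by (intro mult_mono) (auto simp: mult_ac)
  finally show ?thesis using 1 arc_bound_nonneg[of t \<theta>] by (simp add: mult_ac)
next
  case False
  have "(t / 2) ^ 4 \<le> \<bar>\<theta>\<bar> ^ 4" using False t by (intro power_mono) auto
  then have "t ^ 4 \<le> 16 * \<theta> ^ 4" by (simp add: power_divide)
  then have "1 - 16 * \<theta> ^ 4 / t ^ 4 \<le> 0" using t by (simp add: field_simps)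
  then have "exp (- (pi\<^sup>2 / 6 / t ^ 3 * \<theta>\<^sup>2)) * (1 - 16 * \<theta> ^ 4 / t ^ 4) \<le> 0"
    by (simp add: mult_nonneg_nonpos)
  moreover have "0 \<le> (25 / 24 * (pi\<^sup>2 / 6))\<^sup>2 / 2 * \<theta> ^ 6 / t ^ 8 * exp (- (pi / 4 / t ^ 3 * \<theta>\<^sup>2))"
    using t by simp
  moreover have "- arc_bound t \<theta> \<le> exp (- decay t \<theta>) * cos (phase t \<theta>)"
  proof -
    have "- exp (- decay t \<theta>) \<le> exp (- decay t \<theta>) * cos (phase t \<theta>)"
      using mult_left_mono[OF cos_ge_minus_one[of "phase t \<theta>"], of "exp (- decay t \<theta>)"] by simp
    then show ?thesis using exp_decay_le_arc_bound[of t \<theta>] t \<theta> False by linarith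
  qed
  ultimately show ?thesis by linarith
qed

section \<open>Integral estimates\<close>

lemma has_integral_gaussian_moment:
  fixes a :: real
  assumes "0 < a"
  shows "((\<lambda>x. x ^ (2 * k) * exp (- (a * x\<^sup>2))) has_integral
           (sqrt (pi / a) * (fact (2 * k) / ((4 * a) ^ k * fact k)))) UNIV"
proof -
  define \<sigma> where "\<sigma> = sqrt (1 / (2 * a))"
  have \<sigma>: "0 < \<sigma>" "\<sigma>\<^sup>2 = 1 / (2 * a)" using assms by (auto simp: \<sigma>_def)
  have "((\<lambda>x. normal_density 0 \<sigma> x * (x - 0) ^ (2 * k)) has_integral
      (fact (2 * k) / ((2 / \<sigma>\<^sup>2) ^ k * fact k))) UNIV"
    using has_integral_integral_lborel[OF integrable.intros[OF normal_moment_even[OF \<sigma>(1), of 0 k]]]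
    unfolding integral_normal_moment_even[OF \<sigma>(1)] .
  then have "((\<lambda>x. sqrt (pi / a) * (normal_density 0 \<sigma> x * (x - 0) ^ (2 * k))) has_integral
      (sqrt (pi / a) * (fact (2 * k) / ((2 / \<sigma>\<^sup>2) ^ k * fact k)))) UNIV"
    by (rule has_integral_mult_right)
  moreover have "sqrt (pi / a) * (normal_density 0 \<sigma> x * (x - 0) ^ (2 * k)) = x ^ (2 * k) * exp (- (a * x\<^sup>2))" for x
  proof -
    have "2 * pi * \<sigma>\<^sup>2 = pi / a" "2 * \<sigma>\<^sup>2 = 1 / a" using assms by (auto simp: \<sigma>(2))
    then have "normal_density 0 \<sigma> x = 1 / sqrt (pi / a) * exp (- (a * x\<^sup>2))"
      by (simp only: normal_density_def) (simp add: mult.commute)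
    then show ?thesis using assms by simp
  qed
  moreover have "2 / \<sigma>\<^sup>2 = 4 * a" using assms by (simp add: \<sigma>(2))
  ultimately show ?thesis by (simp only:)
qed

lemma has_integral_half_square:
  fixes s :: real
  assumes "0 \<le> s"
  shows "((\<lambda>x. x\<^sup>2 / 2) has_integral (s ^ 3 / 3)) {-s..s}"
proof -
  have "((\<lambda>x. x\<^sup>2 / 2) has_integral (s ^ 3 / 6 - (- s) ^ 3 / 6)) {-s..s}"
  proof (rule fundamental_theorem_of_calculus)
    fix x :: real
    show "((\<lambda>x. x ^ 3 / 6) has_vector_derivative x\<^sup>2 / 2) (at x within {-s..s})"
      unfolding has_real_derivative_iff_has_vector_derivative[symmetric]
      by (auto intro!: derivative_eq_intros)
  qed (use assms in simp)
  then show ?thesis by simp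
qed

lemma has_integral_arc_bound:
  assumes "0 < t" "t \<le> 43 / 1000"
  shows "(arc_bound t has_integral (2 * t * exp (- (198 / 1000 / t)) + 8 * t * exp (- (497 / 1000 / t))
           + 2 * pi * exp (- (93 / 100 / t)))) {-pi..pi}"
proof -
  have sub: "{-t..t} \<subseteq> {-pi..pi}" "{-4 * t..4 * t} \<subseteq> {-pi..pi}"
    using assms pi_gt3 by auto
  have const: "((\<lambda>x. c) has_integral (2 * s * c)) {-s..s}" if "0 \<le> s" for s c :: real
    using has_integral_const_real[of c "-s" s] that by simp
  have "((\<lambda>\<theta>. (if \<theta> \<in> {-t..t} then exp (- (198 / 1000 / t)) else 0)
     + (if \<theta> \<in> {-4 * t..4 * t} then exp (- (497 / 1000 / t)) else 0) + exp (- (93 / 100 / t))) has_integral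
       (2 * t * exp (- (198 / 1000 / t)) + 2 * (4 * t) * exp (- (497 / 1000 / t)) + 2 * pi * exp (- (93 / 100 / t)))) {-pi..pi}"
    using const[of t] const[of "4 * t"] const[of pi] assms sub
    by (intro has_integral_add) (auto simp del: atLeastAtMost_iff)
  then show ?thesis by (simp add: arc_bound_def[abs_def])
qed

text \<open>A majorant of \<open>arc_bound\<close> times 1 - cos \<theta>. The weight is replaced by
  \<theta>^2/2 on the two arcs, which gains a factor t^2, but only by 2 in the far term, which must
  be small enough by itself.\<close>

lemma has_integral_arc_bound_weighted:
  assumes "0 < t" "t \<le> 43 / 1000"
  shows "((\<lambda>\<theta>. (if \<theta> \<in> {-t..t} then \<theta>\<^sup>2 / 2 * exp (- (198 / 1000 / t)) else 0)
     + (if \<theta> \<in> {-4 * t..4 * t} then \<theta>\<^sup>2 / 2 * exp (- (497 / 1000 / t)) else 0) + 2 * exp (- (93 / 100 / t))) has_integral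
     (t ^ 3 / 3 * exp (- (198 / 1000 / t)) + 64 * t ^ 3 / 3 * exp (- (497 / 1000 / t))
           + 4 * pi * exp (- (93 / 100 / t)))) {-pi..pi}"
proof -
  have sub: "{-t..t} \<subseteq> {-pi..pi}" "{-(4 * t)..4 * t} \<subseteq> {-pi..pi}"
    using assms pi_gt3 by auto
  have sq: "((\<lambda>x. x\<^sup>2 / 2 * c) has_integral (s ^ 3 / 3 * c)) {-s..s}" if "0 \<le> s" for s c :: real
    using has_integral_half_square[OF that] by (rule has_integral_mult_left)
  have "((\<lambda>x. 2 * exp (- (93 / 100 / t))) has_integral (2 * pi * (2 * exp (- (93 / 100 / t))))) {-pi..pi}"
    using has_integral_const_real[of "2 * exp (- (93 / 100 / t))" "-pi" pi] by simp
  then have "((\<lambda>\<theta>. (if \<theta> \<in> {-t..t} then \<theta>\<^sup>2 / 2 * exp (- (198 / 1000 / t)) else 0)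
     + (if \<theta> \<in> {-(4 * t)..4 * t} then \<theta>\<^sup>2 / 2 * exp (- (497 / 1000 / t)) else 0) + 2 * exp (- (93 / 100 / t))) has_integral
     (t ^ 3 / 3 * exp (- (198 / 1000 / t)) + (4 * t) ^ 3 / 3 * exp (- (497 / 1000 / t))
           + 2 * pi * (2 * exp (- (93 / 100 / t))))) {-pi..pi}"
    using sq[of t] sq[of "4 * t"] assms sub
    by (intro has_integral_add) (simp_all del: atLeastAtMost_iff)
  then show ?thesis by (simp add: power_mult_distrib mult_ac)
qed

text \<open>For j > 0, exp(-a/t) t^(-j) increases in t as long as t \<le> a/j, so on (0, \<tau>] it
  is largest at \<tau>. Exponentially small terms thus become powers of t with a constant evaluated
  at \<tau> alone.\<close>

lemma exp_neg_div_le_power: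
  fixes t \<tau> :: real
  assumes "0 < t" "t \<le> \<tau>" "real j \<le> a / \<tau>"
  shows "exp (- (a / t)) \<le> exp (- (a / \<tau>)) * (t / \<tau>) ^ j"
proof -
  have \<tau>: "0 < \<tau>" using assms by simp
  have "ln (\<tau> / t) \<le> \<tau> / t - 1" using assms \<tau> by (intro ln_le_minus_one) auto
  then have "real j * ln (\<tau> / t) \<le> real j * (\<tau> / t - 1)" by (intro mult_left_mono) auto
  also have "\<dots> \<le> a / \<tau> * (\<tau> / t - 1)" using assms \<tau> by (intro mult_right_mono) auto
  also have "\<dots> = a / t - a / \<tau>" using assms \<tau> by (simp add: field_simps)
  finally have "- (a / t) \<le> - (a / \<tau>) + real j * ln (t / \<tau>)"
    using assms \<tau> by (simp add: ln_div algebra_simps)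
  then have "exp (- (a / t)) \<le> exp (- (a / \<tau>) + real j * ln (t / \<tau>))" by simp
  also have "\<dots> = exp (- (a / \<tau>)) * (t / \<tau>) ^ j"
    using assms \<tau> by (simp only: exp_add exp_of_nat_mult) simp
  finally show ?thesis .
qed

text \<open>At t = 43/1000 the exponents are about 4.60, 11.56 and 21.63. The powers 2, 2 and 5 turn
  every term of the weighted arc integral into a multiple of t^5, below the main order
  t^(9/2).\<close>

lemma arc_exponentials:
  fixes t :: real
  assumes "0 < t" "t \<le> 43 / 1000"
  shows "exp (- (198 / 1000 / t)) \<le> 102 / 10000 * (t / (43 / 1000))\<^sup>2"
    and "exp (- (497 / 1000 / t)) \<le> 17 / 1000000 * (t / (43 / 1000))\<^sup>2"
    and "exp (- (93 / 100 / t)) \<le> 8 / 10 ^ 10 * (t / (43 / 1000)) ^ 5"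
proof -
  have scale: "exp (- (a / t)) \<le> c * (t / (43 / 1000)) ^ j"
    if "exp y \<ge> 1 / c" "0 < c" "y \<le> a / (43 / 1000)" "real j \<le> a / (43 / 1000)" for a c y j
  proof -
    have "1 / c \<le> exp (a / (43 / 1000))" using that(1,3) by (meson exp_le_cancel_iff order_trans)
    then have "exp (- (a / (43 / 1000))) \<le> c" using that(2) by (simp add: exp_minus field_simps)
    then have "exp (- (a / (43 / 1000))) * (t / (43 / 1000)) ^ j \<le> c * (t / (43 / 1000)) ^ j"
      using assms by (intro mult_right_mono) auto
    then show ?thesis using exp_neg_div_le_power[OF assms that(4)] by linarith
  qed
  have e: "2718 / 1000 \<le> exp (1 :: real)"
    using e_approx_32 by (simp add: abs_if split: if_splits)
  have e_pow: "(2718 / 1000) ^ k \<le> exp (real k)" for k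
    using power_mono[OF e, of k] by (simp add: exp_of_nat_mult[of _ 1, simplified])
  \<comment> \<open>Fifth powers turn the exponent 46/10 into the integer 23, where e \<ge> 2.718
    applies.\<close>
  have "(10000 / 102) ^ 5 \<le> (2718 / 1000 :: real) ^ 23" by (simp add: power_divide)
  also have "\<dots> \<le> exp (46 / 10) ^ 5" using e_pow[of 23] by (simp flip: exp_of_nat_mult)
  finally have "10000 / 102 \<le> exp (46 / 10 :: real)" by (rule power_le_imp_le_base[of _ 4, simplified]) simp
  then show "exp (- (198 / 1000 / t)) \<le> 102 / 10000 * (t / (43 / 1000))\<^sup>2"
    by (intro scale[of _ "46 / 10"]) auto
  have "1000000 / 17 \<le> (2718 / 1000 :: real) ^ 11" by (simp add: power_divide)
  then show "exp (- (497 / 1000 / t)) \<le> 17 / 1000000 * (t / (43 / 1000))\<^sup>2"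
    using e_pow[of 11] by (intro scale[of _ 11]) auto
  have "10 ^ 10 / 8 \<le> (2718 / 1000 :: real) ^ 21" by (simp add: power_divide)
  then show "exp (- (93 / 100 / t)) \<le> 8 / 10 ^ 10 * (t / (43 / 1000)) ^ 5"
    using e_pow[of 21] by (intro scale[of _ 21]) auto
qed

section \<open>Integrals in powers of w, the square root of t\<close>

context
  fixes w t :: real
  assumes w: "0 < w" and t_def: "t = w\<^sup>2" and t_le: "t \<le> 43 / 1000"
begin

private lemma t_pos: "0 < t" using w t_def by simp

text \<open>The number lies just above the square root of 43/1000; spare powers of w are absorbed
  into constants by it.\<close>

private lemma w_le: "w \<le> 2074 / 10000"
proof (rule power2_le_imp_le)
  show "w\<^sup>2 \<le> (2074 / 10000)\<^sup>2" using t_le t_def by (simp add: power2_eq_square)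
qed simp

private lemma w_power_le: "w ^ k \<le> (2074 / 10000) ^ k"
  using w w_le by (intro power_mono) auto

lemma arc_bound_integral_le:
  "2 * t * exp (- (198 / 1000 / t)) + 8 * t * exp (- (497 / 1000 / t)) + 2 * pi * exp (- (93 / 100 / t))
    \<le> 1 / 10 * w ^ 3"
proof -
  have "2 * t * exp (- (198 / 1000 / t)) + 8 * t * exp (- (497 / 1000 / t)) + 2 * pi * exp (- (93 / 100 / t))
    \<le> 2 * t * (102 / 10000 * (t / (43 / 1000))\<^sup>2) + 8 * t * (17 / 1000000 * (t / (43 / 1000))\<^sup>2)
      + 2 * (32 / 10) * (8 / 10 ^ 10 * (t / (43 / 1000)) ^ 5)"
    using t_pos t_le pi_approx by (intro add_mono mult_mono mult_left_mono arc_exponentials) auto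
  also have "\<dots> = w ^ 3 * ((2 * (102 / 10000) + 8 * (17 / 1000000)) / (43 / 1000)\<^sup>2 * w ^ 3
      + 2 * (32 / 10) * 8 / 10 ^ 10 / (43 / 1000) ^ 5 * w ^ 7)"
    by (simp add: t_def power_divide field_simps flip: power_mult power_add)
  also have "\<dots> \<le> w ^ 3 * ((2 * (102 / 10000) + 8 * (17 / 1000000)) / (43 / 1000)\<^sup>2 * (2074 / 10000) ^ 3
      + 2 * (32 / 10) * 8 / 10 ^ 10 / (43 / 1000) ^ 5 * (2074 / 10000) ^ 7)"
    using w by (intro mult_left_mono add_mono w_power_le) auto
  also have "\<dots> \<le> w ^ 3 * (1 / 10)"
    using w by (intro mult_left_mono) (simp_all add: power_divide)
  finally show ?thesis by simp
qed

lemma arc_bound_weighted_integral_le: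
  "t ^ 3 / 3 * exp (- (198 / 1000 / t)) + 64 * t ^ 3 / 3 * exp (- (497 / 1000 / t))
           + 4 * pi * exp (- (93 / 100 / t)) \<le> 44 / 100 * w ^ 9"
proof -
  have "t ^ 3 / 3 * exp (- (198 / 1000 / t)) + 64 * t ^ 3 / 3 * exp (- (497 / 1000 / t))
           + 4 * pi * exp (- (93 / 100 / t))
    \<le> t ^ 3 / 3 * (102 / 10000 * (t / (43 / 1000))\<^sup>2) + 64 * t ^ 3 / 3 * (17 / 1000000 * (t / (43 / 1000))\<^sup>2)
      + 4 * (32 / 10) * (8 / 10 ^ 10 * (t / (43 / 1000)) ^ 5)"
    using t_pos t_le pi_approx by (intro add_mono mult_mono mult_left_mono arc_exponentials) auto
  also have "\<dots> = w ^ 9 * (((102 / 10000) / 3 + 64 / 3 * (17 / 1000000)) / (43 / 1000)\<^sup>2 * w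
      + 4 * (32 / 10) * 8 / 10 ^ 10 / (43 / 1000) ^ 5 * w)"
    by (simp add: t_def power_divide field_simps flip: power_mult power_add)
       (simp add: eval_nat_numeral)
  also have "\<dots> \<le> w ^ 9 * (((102 / 10000) / 3 + 64 / 3 * (17 / 1000000)) / (43 / 1000)\<^sup>2 * (2074 / 10000)
      + 4 * (32 / 10) * 8 / 10 ^ 10 / (43 / 1000) ^ 5 * (2074 / 10000))"
    using w by (intro mult_left_mono add_mono w_le) auto
  also have "\<dots> \<le> w ^ 9 * (44 / 100)"
    using w by (intro mult_left_mono) (simp_all add: power_divide)
  finally show ?thesis by simp
qed

private lemma gaussian_width: "sqrt (pi / (pi / 4 / t ^ 3)) = 2 * w ^ 3"
proof -
  have "pi / (pi / 4 / t ^ 3) = (2 * w ^ 3)\<^sup>2"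
    by (simp add: t_def power_mult_distrib flip: power_mult)
  then show ?thesis using w by (simp add: real_sqrt_unique)
qed

private lemma arc_has_integral_UNIV:
  "((\<lambda>\<theta>. if \<theta> \<in> {-pi..pi} then f \<theta> else 0) has_integral i) UNIV" if "(f has_integral i) {-pi..pi}" for f :: "real \<Rightarrow> real" and i
  using that by (simp del: atLeastAtMost_iff)

lemma integral_exp_decay_le:
  assumes "((\<lambda>\<theta>. exp (- decay t \<theta>)) has_integral I) {-pi..pi}"
  shows "I \<le> 21 / 10 * w ^ 3"
proof -
  let ?A = "2 * t * exp (- (198 / 1000 / t)) + 8 * t * exp (- (497 / 1000 / t)) + 2 * pi * exp (- (93 / 100 / t))"
  have "((\<lambda>\<theta>. \<theta> ^ (2 * 0) * exp (- (pi / 4 / t ^ 3 * \<theta>\<^sup>2))) has_integral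
      (sqrt (pi / (pi / 4 / t ^ 3)) * (fact (2 * 0) / ((4 * (pi / 4 / t ^ 3)) ^ 0 * fact 0)))) UNIV"
    using t_pos by (intro has_integral_gaussian_moment) simp
  then have "((\<lambda>\<theta>. exp (- (pi / 4 / t ^ 3 * \<theta>\<^sup>2))) has_integral (2 * w ^ 3)) UNIV"
    by (simp only: gaussian_width) simp
  from has_integral_add[OF this arc_has_integral_UNIV[OF has_integral_arc_bound[OF t_pos t_le]]]
  have "I \<le> 2 * w ^ 3 + ?A"
  proof (rule has_integral_le[OF arc_has_integral_UNIV[OF assms]])
    fix \<theta> :: real
    show "(if \<theta> \<in> {-pi..pi} then exp (- decay t \<theta>) else 0)
        \<le> exp (- (pi / 4 / t ^ 3 * \<theta>\<^sup>2)) + (if \<theta> \<in> {-pi..pi} then arc_bound t \<theta> else 0)"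
      using exp_decay_le[of t \<theta>] t_pos t_le by auto
  qed
  then show ?thesis using arc_bound_integral_le by simp
qed

text \<open>The second Gaussian moment gives 2/\<pi> w^9, at most 0.64 w^9; the arcs add at most
  0.44 w^9.\<close>

lemma integral_exp_decay_cos_le:
  assumes "((\<lambda>\<theta>. exp (- decay t \<theta>) * (1 - cos \<theta>)) has_integral J) {-pi..pi}"
  shows "J \<le> 108 / 100 * w ^ 9"
proof -
  let ?A = "t ^ 3 / 3 * exp (- (198 / 1000 / t)) + 64 * t ^ 3 / 3 * exp (- (497 / 1000 / t)) + 4 * pi * exp (- (93 / 100 / t))"
  let ?g = "\<lambda>\<theta>. exp (- (pi / 4 / t ^ 3 * \<theta>\<^sup>2))"
  let ?b = "\<lambda>\<theta>. (if \<theta> \<in> {-t..t} then \<theta>\<^sup>2 / 2 * exp (- (198 / 1000 / t)) else 0)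
     + (if \<theta> \<in> {-4 * t..4 * t} then \<theta>\<^sup>2 / 2 * exp (- (497 / 1000 / t)) else 0) + 2 * exp (- (93 / 100 / t))"
  have "((\<lambda>\<theta>. 1 / 2 * (\<theta> ^ (2 * 1) * ?g \<theta>)) has_integral
      (1 / 2 * (sqrt (pi / (pi / 4 / t ^ 3)) * (fact (2 * 1) / ((4 * (pi / 4 / t ^ 3)) ^ 1 * fact 1))))) UNIV"
    using t_pos by (intro has_integral_mult_right has_integral_gaussian_moment) simp
  moreover have "1 / 2 * (2 * w ^ 3 * (fact (2 * 1) / ((4 * (pi / 4 / t ^ 3)) ^ 1 * fact 1))) = 2 / pi * w ^ 9"
    by (simp add: t_def flip: power_mult power_add)
  ultimately have "((\<lambda>\<theta>. \<theta>\<^sup>2 / 2 * ?g \<theta>) has_integral (2 / pi * w ^ 9)) UNIV"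
    by (simp only: gaussian_width) simp
  from has_integral_add[OF this arc_has_integral_UNIV[OF has_integral_arc_bound_weighted[OF t_pos t_le]]]
  have "J \<le> 2 / pi * w ^ 9 + ?A"
  proof (rule has_integral_le[OF arc_has_integral_UNIV[OF assms]])
    fix \<theta> :: real
    have "exp (- decay t \<theta>) * (1 - cos \<theta>) \<le> \<theta>\<^sup>2 / 2 * ?g \<theta> + ?b \<theta>" if "\<theta> \<in> {-pi..pi}"
    proof -
      have "exp (- decay t \<theta>) * (1 - cos \<theta>) \<le> (?g \<theta> + arc_bound t \<theta>) * (1 - cos \<theta>)"
        using exp_decay_le[of t \<theta>] t_pos t_le that by (intro mult_right_mono) auto
      also have "\<dots> = ?g \<theta> * (1 - cos \<theta>) + arc_bound t \<theta> * (1 - cos \<theta>)" by (simp add: distrib_right)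
      also have "?g \<theta> * (1 - cos \<theta>) \<le> ?g \<theta> * (\<theta>\<^sup>2 / 2)"
        by (intro mult_left_mono one_minus_cos_le) simp
      also have "arc_bound t \<theta> * (1 - cos \<theta>) \<le> ?b \<theta>"
        unfolding arc_bound_def distrib_right
      proof (intro add_mono)
        show "exp (- (93 / 100 / t)) * (1 - cos \<theta>) \<le> 2 * exp (- (93 / 100 / t))"
          using cos_ge_minus_one[of \<theta>] by (simp add: mult.commute)
      qed (use one_minus_cos_le[of \<theta>] in \<open>auto simp: mult.commute intro!: mult_left_mono\<close>)
      finally show ?thesis by (simp add: mult.commute)
    qed
    then show "(if \<theta> \<in> {-pi..pi} then exp (- decay t \<theta>) * (1 - cos \<theta>) else 0)
        \<le> \<theta>\<^sup>2 / 2 * ?g \<theta> + (if \<theta> \<in> {-pi..pi} then ?b \<theta> else 0)" by simp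
  qed
  moreover have "2 / pi * w ^ 9 \<le> 64 / 100 * w ^ 9"
    using w pi_approx by (intro mult_right_mono) (auto simp: field_simps)
  ultimately show ?thesis using arc_bound_weighted_integral_le by simp
qed

text \<open>The balance in units of w^3: the Gaussian of rate \<pi>^2/6 gives sqrt(6/\<pi>) > 1.38,
  the quartic cutoff costs at most one percent of that, the phase 0.49 and the arcs 0.1, which
  leaves more than 0.77.\<close>

lemma integral_exp_decay_cos_phase_ge:
  assumes "((\<lambda>\<theta>. exp (- decay t \<theta>) * cos (phase t \<theta>)) has_integral P) {-pi..pi}"
  shows "77 / 100 * w ^ 3 \<le> P"
proof -
  let ?A = "2 * t * exp (- (198 / 1000 / t)) + 8 * t * exp (- (497 / 1000 / t)) + 2 * pi * exp (- (93 / 100 / t))"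
  define a where "a = pi\<^sup>2 / 6 / t ^ 3"
  have a: "0 < a" using t_pos by (simp add: a_def)
  define W where "W = sqrt (pi / a)"
  define K where "K = (25 / 24 * (pi\<^sup>2 / 6))\<^sup>2 / 2 / t ^ 8"
  let ?g = "\<lambda>\<theta>. exp (- (pi / 4 / t ^ 3 * \<theta>\<^sup>2))"
  let ?h = "\<lambda>\<theta>. exp (- (a * \<theta>\<^sup>2))"
  have h0: "(?h has_integral W) UNIV"
    using has_integral_gaussian_moment[OF a, of 0] by (simp add: W_def)
  have "((\<lambda>\<theta>. 16 / t ^ 4 * (\<theta> ^ (2 * 2) * ?h \<theta>)) has_integral (16 / t ^ 4 * (W * (fact (2 * 2) / ((4 * a) ^ 2 * fact 2))))) UNIV"
    unfolding W_def by (intro has_integral_mult_right has_integral_gaussian_moment a)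
  moreover have "16 / t ^ 4 * (W * (fact (2 * 2) / ((4 * a) ^ 2 * fact 2))) = W * (432 / pi ^ 4 * t\<^sup>2)"
    using t_pos by (simp add: a_def fact_numeral field_simps eval_nat_numeral)
  moreover have "(\<lambda>\<theta>. 16 / t ^ 4 * (\<theta> ^ (2 * 2) * ?h \<theta>)) = (\<lambda>\<theta>. 16 * \<theta> ^ 4 / t ^ 4 * ?h \<theta>)"
    by (simp add: fun_eq_iff)
  ultimately have h4: "((\<lambda>\<theta>. 16 * \<theta> ^ 4 / t ^ 4 * ?h \<theta>) has_integral (W * (432 / pi ^ 4 * t\<^sup>2))) UNIV"
    by (simp only:)
  have "((\<lambda>\<theta>. K * (\<theta> ^ (2 * 3) * ?g \<theta>)) has_integral
      (K * (sqrt (pi / (pi / 4 / t ^ 3)) * (fact (2 * 3) / ((4 * (pi / 4 / t ^ 3)) ^ 3 * fact 3))))) UNIV"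
    using t_pos by (intro has_integral_mult_right has_integral_gaussian_moment) simp
  moreover have "K * (2 * w ^ 3 * (fact (2 * 3) / ((4 * (pi / 4 / t ^ 3)) ^ 3 * fact 3))) = 150000 / 41472 * pi * t * w ^ 3"
    using t_pos by (simp add: K_def fact_numeral field_simps eval_nat_numeral)
  ultimately have g6: "((\<lambda>\<theta>. K * \<theta> ^ 6 * ?g \<theta>) has_integral (150000 / 41472 * pi * t * w ^ 3)) UNIV"
    by (simp only: gaussian_width) (simp add: mult.assoc)
  have "W - W * (432 / pi ^ 4 * t\<^sup>2) - 150000 / 41472 * pi * t * w ^ 3 - ?A \<le> P"
  proof (rule has_integral_le[OF has_integral_diff[OF has_integral_diff[OF has_integral_diff[OF h0 h4] g6]
        arc_has_integral_UNIV[OF has_integral_arc_bound[OF t_pos t_le]]] arc_has_integral_UNIV[OF assms]])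
    fix \<theta> :: real
    show "?h \<theta> - 16 * \<theta> ^ 4 / t ^ 4 * ?h \<theta> - K * \<theta> ^ 6 * ?g \<theta> - (if \<theta> \<in> {-pi..pi} then arc_bound t \<theta> else 0)
       \<le> (if \<theta> \<in> {-pi..pi} then exp (- decay t \<theta>) * cos (phase t \<theta>) else 0)"
    proof (cases "\<theta> \<in> {-pi..pi}")
      case True
      then show ?thesis
        using exp_decay_cos_phase_ge[of t \<theta>] t_pos t_le by (auto simp: a_def K_def algebra_simps)
    next
      case False
      then have "t / 2 \<le> \<bar>\<theta>\<bar>" using t_le pi_gt3 by auto
      then have "(t / 2) ^ 4 \<le> \<bar>\<theta>\<bar> ^ 4" using t_pos by (intro power_mono) auto
      then have "1 \<le> 16 * \<theta> ^ 4 / t ^ 4" using t_pos by (simp add: power_divide field_simps)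
      then have "1 * ?h \<theta> \<le> 16 * \<theta> ^ 4 / t ^ 4 * ?h \<theta>" by (intro mult_right_mono) auto
      moreover have "0 \<le> K * \<theta> ^ 6 * ?g \<theta>" by (simp add: K_def)
      ultimately show ?thesis using False by auto
    qed
  qed
  moreover have "138 / 100 * w ^ 3 \<le> W"
    unfolding W_def
  proof (rule real_le_rsqrt)
    have "t ^ 3 = (w ^ 3)\<^sup>2" by (simp add: t_def flip: power_mult)
    then have "pi / a = 6 / pi * (w ^ 3)\<^sup>2"
      by (simp add: a_def power2_eq_square[of pi])
    moreover have "(138 / 100)\<^sup>2 * (w ^ 3)\<^sup>2 \<le> 6 / pi * (w ^ 3)\<^sup>2"
      using pi_approx by (intro mult_right_mono) (auto simp: field_simps power2_eq_square)
    ultimately show "(138 / 100 * w ^ 3)\<^sup>2 \<le> pi / a" by (simp only: power_mult_distrib)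
  qed
  moreover have "432 / pi ^ 4 * t\<^sup>2 \<le> 1 / 100"
  proof -
    have "81 \<le> pi ^ 4" using power_mono[of 3 pi 4] pi_gt3 by simp
    then have "432 / pi ^ 4 \<le> 432 / 81" by (intro divide_left_mono) auto
    then have "432 / pi ^ 4 * t\<^sup>2 \<le> 432 / 81 * (43 / 1000)\<^sup>2"
      using t_pos t_le by (intro mult_mono power_mono) auto
    also have "\<dots> \<le> 1 / 100" by (simp add: power2_eq_square)
    finally show ?thesis .
  qed
  then have "W * (432 / pi ^ 4 * t\<^sup>2) \<le> W * (1 / 100)"
    using a by (intro mult_left_mono) (auto simp: W_def)
  moreover have "150000 / 41472 * pi * t * w ^ 3 \<le> 49 / 100 * w ^ 3"
  proof (rule mult_right_mono)
    have "pi * t \<le> 315 / 100 * (43 / 1000)" using t_pos t_le pi_approx by (intro mult_mono) auto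
    then show "150000 / 41472 * pi * t \<le> 49 / 100" by simp
  qed (use w in simp)
  moreover have "0 \<le> w ^ 3" using w by simp
  ultimately show ?thesis using arc_bound_integral_le by linarith
qed

end

section \<open>Comparison of adjacent coefficients\<close>

text \<open>Intermediate value theorem on [0, r] with r = n/(n + 1): the coefficients \<sigma>(N)
  are at least 1 for N > 0, so the series at r is at least r + r^2 + ... = r/(1 - r) = n.\<close>

lemma saddle_point_exists:
  fixes n :: nat
  assumes "0 < n"
  obtains t :: real where "0 < t" "(\<Sum>N. real N * log_coeff N * exp (- t) ^ N) = real n"
proof -
  define f where "f x = (\<Sum>N. real N * log_coeff N * x ^ N)" for x :: real
  have summable: "summable (\<lambda>N. real N * log_coeff N * x ^ N)" if "0 < x" "x < 1" for x :: real
  proof -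
    have "exp (- (- ln x)) = x" "0 < - ln x" using that by auto
    then show ?thesis using log_coeff_moments(2)[of "- ln x"] by simp
  qed
  define r where "r = real n / (real n + 1)"
  have r: "0 < r" "r < 1" "1 / (1 - r) - 1 = real n"
    using assms by (auto simp: r_def field_simps)
  have "continuous_on {0..r} f"
  proof (intro continuous_at_imp_continuous_on ballI)
    fix x assume x: "x \<in> {0..r}"
    then have "summable (\<lambda>N. real N * log_coeff N * ((1 + r) / 2) ^ N)"
      using r by (intro summable) auto
    then show "isCont f x"
      unfolding f_def by (rule isCont_powser) (use x r in auto)
  qed
  moreover have f0: "f 0 = 0"
    using powser_zero[of "\<lambda>N. real N * log_coeff N"] by (simp add: f_def)
  moreover have "real n \<le> f r"
  proof -
    have "(\<lambda>N. r ^ N - (if N = 0 then 1 else 0)) sums (1 / (1 - r) - 1)"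
      using r sums_single[of 0 "\<lambda>_. 1 :: real"] by (intro sums_diff geometric_sums) auto
    moreover have "(\<lambda>N. real N * log_coeff N * r ^ N) sums f r"
      unfolding f_def using r by (intro summable_sums summable) auto
    moreover have "r ^ N - (if N = 0 then 1 else 0) \<le> real N * log_coeff N * r ^ N" for N
    proof (cases "N = 0")
      case False
      then have "1 * 1 \<le> real N * log_coeff N"
        using log_coeff_ge_1[of N] by (intro mult_mono) auto
      then have "1 * r ^ N \<le> real N * log_coeff N * r ^ N"
        using r by (intro mult_right_mono) auto
      then show ?thesis using False by simp
    qed simp
    ultimately have "1 / (1 - r) - 1 \<le> f r" by (rule sums_le[rotated 1])
    then show ?thesis using r by simp
  qed
  ultimately obtain x where x: "0 \<le> x" "x \<le> r" "f x = real n"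
    using IVT'[of f 0 "real n" r] r by auto
  have "x \<noteq> 0" using f0 x(3) assms by auto
  then have "0 < x" "x < 1" using x r by auto
  then have "0 < - ln x" "exp (- (- ln x)) = x" by auto
  then show thesis using that[of "- ln x"] x(3) by (simp add: f_def)
qed

text \<open>The mean of the two twists is cos \<theta>, half their difference is -i sin \<theta>. In
  place of Cauchy-Schwarz the pointwise bound |sin \<theta>| \<le> \<epsilon>/2 + (1 - cos
  \<theta>)/\<epsilon> is integrated. The later choice \<epsilon> = w^3 is close to the optimum
  sqrt(2 J/I) for the available bounds on I and J.\<close>

lemma adjacent_fourier_bounds:
  fixes H :: "real \<Rightarrow> complex" and P0 P1 Pm I J \<epsilon> :: real
  assumes P0: "(H has_integral of_real P0) {-pi..pi}"
    and P1: "((\<lambda>\<theta>. H \<theta> * cis (- \<theta>)) has_integral of_real P1) {-pi..pi}"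
    and Pm: "((\<lambda>\<theta>. H \<theta> * cis \<theta>) has_integral of_real Pm) {-pi..pi}"
    and I: "((\<lambda>\<theta>. norm (H \<theta>)) has_integral I) {-pi..pi}"
    and J: "((\<lambda>\<theta>. norm (H \<theta>) * (1 - cos \<theta>)) has_integral J) {-pi..pi}"
    and \<epsilon>: "0 < \<epsilon>"
  shows "\<bar>P0 - (P1 + Pm) / 2\<bar> \<le> J" and "\<bar>(P1 - Pm) / 2\<bar> \<le> \<epsilon> / 2 * I + J / \<epsilon>"
proof -
  have "((\<lambda>\<theta>. H \<theta> - (H \<theta> * cis (- \<theta>) + H \<theta> * cis \<theta>) * (1 / 2)) has_integral
      (of_real P0 - (of_real P1 + of_real Pm) * (1 / 2))) {-pi..pi}"
    by (intro has_integral_diff has_integral_mult_left has_integral_add P0 P1 Pm)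
  moreover have "H \<theta> - (H \<theta> * cis (- \<theta>) + H \<theta> * cis \<theta>) * (1 / 2) = H \<theta> * of_real (1 - cos \<theta>)" for \<theta>
    by (simp add: complex_eq_iff field_simps)
  ultimately have "((\<lambda>\<theta>. H \<theta> * of_real (1 - cos \<theta>)) has_integral of_real (P0 - (P1 + Pm) / 2)) {-pi..pi}"
    by simp
  from has_integral_norm_bound_integral_component[OF this J, of 1]
  show "\<bar>P0 - (P1 + Pm) / 2\<bar> \<le> J" by (simp add: norm_mult del: of_real_diff of_real_add of_real_divide)
  have "((\<lambda>\<theta>. (H \<theta> * cis (- \<theta>) - H \<theta> * cis \<theta>) * (1 / 2)) has_integral
      ((of_real P1 - of_real Pm) * (1 / 2))) {-pi..pi}"
    by (intro has_integral_diff has_integral_mult_left P1 Pm)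
  moreover have "(H \<theta> * cis (- \<theta>) - H \<theta> * cis \<theta>) * (1 / 2) = H \<theta> * (- \<i> * of_real (sin \<theta>))" for \<theta>
    by (simp add: complex_eq_iff field_simps)
  ultimately have HS: "((\<lambda>\<theta>. H \<theta> * (- \<i> * of_real (sin \<theta>))) has_integral of_real ((P1 - Pm) / 2)) {-pi..pi}"
    by simp
  have HB: "((\<lambda>\<theta>. \<epsilon> / 2 * norm (H \<theta>) + norm (H \<theta>) * (1 - cos \<theta>) / \<epsilon>) has_integral (\<epsilon> / 2 * I + J / \<epsilon>)) {-pi..pi}"
    using has_integral_mult_right[OF I] has_integral_divide[OF J] by (rule has_integral_add)
  have le: "norm (H \<theta> * (- \<i> * of_real (sin \<theta>))) \<le> \<epsilon> / 2 * norm (H \<theta>) + norm (H \<theta>) * (1 - cos \<theta>) / \<epsilon>" for \<theta>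
  proof -
    have "2 * \<epsilon> * \<bar>sin \<theta>\<bar> \<le> \<epsilon>\<^sup>2 + \<bar>sin \<theta>\<bar>\<^sup>2"
      using zero_le_power2[of "\<epsilon> - \<bar>sin \<theta>\<bar>"] by (simp add: power2_eq_square algebra_simps)
    moreover have "\<bar>sin \<theta>\<bar>\<^sup>2 \<le> 2 * (1 - cos \<theta>)"
    proof -
      have "\<bar>sin \<theta>\<bar>\<^sup>2 = (1 - cos \<theta>) * (1 + cos \<theta>)"
        using sin_squared_eq[of \<theta>] by (simp add: power2_eq_square algebra_simps)
      also have "\<dots> \<le> (1 - cos \<theta>) * 2" by (intro mult_left_mono) auto
      finally show ?thesis by simp
    qed
    ultimately have "\<bar>sin \<theta>\<bar> \<le> \<epsilon> / 2 + (1 - cos \<theta>) / \<epsilon>"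
      using \<epsilon> by (simp add: field_simps power2_eq_square)
    then have "norm (H \<theta>) * \<bar>sin \<theta>\<bar> \<le> norm (H \<theta>) * (\<epsilon> / 2 + (1 - cos \<theta>) / \<epsilon>)"
      by (intro mult_left_mono) auto
    then show ?thesis by (simp add: norm_mult algebra_simps)
  qed
  have "norm (complex_of_real ((P1 - Pm) / 2)) \<le> (\<epsilon> / 2 * I + J / \<epsilon>) \<bullet> 1"
    using HS HB by (rule has_integral_norm_bound_integral_component) (use le in simp)
  then show "\<bar>(P1 - Pm) / 2\<bar> \<le> \<epsilon> / 2 * I + J / \<epsilon>"
    by (simp only: norm_of_real inner_real_def mult_1_right)
qed

text \<open>To be used with v = w^3 and M = n + 1. In P1 * Pm = b^2 - c^2 one has P0^2 - b^2 \<le> 2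
  P0 J, and c is of order v^2. As M v^2 is small, the loss times M is at most 0.16 P0 v + 0.33 v^2;
  this is below P0^2 because P0 \<ge> 0.77 v and 0.77 * 0.61 > 0.33.\<close>

lemma product_of_neighbours_ge:
  fixes P0 P1 Pm I J v M :: real
  assumes v: "0 < v" and M: "0 < M" "M * v\<^sup>2 \<le> 71 / 1000"
    and P0: "77 / 100 * v \<le> P0" and I: "I \<le> 21 / 10 * v" and J: "0 \<le> J" "J \<le> 108 / 100 * v ^ 3"
    and d: "\<bar>P0 - (P1 + Pm) / 2\<bar> \<le> J" and s: "\<bar>(P1 - Pm) / 2\<bar> \<le> v / 2 * I + J / v"
  shows "(M - 1) * P0\<^sup>2 < M * (P1 * Pm)"
proof -
  define b c where "b = (P1 + Pm) / 2" and "c = (P1 - Pm) / 2"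
  have P0_pos: "0 < P0" using P0 v by linarith
  have "v / 2 * I \<le> v / 2 * (21 / 10 * v)" using I v by (intro mult_left_mono) auto
  moreover have "J / v \<le> 108 / 100 * v ^ 3 / v" using J v by (intro divide_right_mono) auto
  moreover have "108 / 100 * v ^ 3 / v = 108 / 100 * v\<^sup>2" using v by (simp add: power2_eq_square power3_eq_cube)
  moreover have "v / 2 * (21 / 10 * v) = 105 / 100 * v\<^sup>2" by (simp add: power2_eq_square)
  ultimately have "\<bar>c\<bar> \<le> 213 / 100 * v\<^sup>2" using s unfolding c_def by linarith
  then have "c\<^sup>2 \<le> (213 / 100 * v\<^sup>2)\<^sup>2" by (rule abs_le_square_iff[THEN iffD1, OF order_trans]) simp
  then have "M * c\<^sup>2 \<le> M * (213 / 100 * v\<^sup>2)\<^sup>2" using M by (intro mult_left_mono) auto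
  also have "\<dots> = (213 / 100)\<^sup>2 * v\<^sup>2 * (M * v\<^sup>2)" by (simp add: power2_eq_square)
  also have "\<dots> \<le> (213 / 100)\<^sup>2 * v\<^sup>2 * (71 / 1000)" using M by (intro mult_left_mono) auto
  also have "\<dots> \<le> 33 / 100 * v\<^sup>2" using v by (simp add: power2_eq_square)
  finally have Mc: "M * c\<^sup>2 \<le> 33 / 100 * v\<^sup>2" .
  have "M * (2 * P0 * J) \<le> M * (2 * P0 * (108 / 100 * v ^ 3))"
    using M P0_pos J by (intro mult_left_mono) auto
  also have "\<dots> = 216 / 100 * (P0 * v) * (M * v\<^sup>2)" by (simp add: power2_eq_square power3_eq_cube)
  also have "\<dots> \<le> 216 / 100 * (P0 * v) * (71 / 1000)" using M P0_pos v by (intro mult_left_mono) auto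
  also have "\<dots> \<le> 16 / 100 * (P0 * v)" using P0_pos v by simp
  finally have MJ: "M * (2 * P0 * J) \<le> 16 / 100 * (P0 * v)" .
  have "P0\<^sup>2 - 2 * P0 * J \<le> b\<^sup>2"
  \<comment> \<open>Squaring P0 - J \<le> b requires a nonnegative left side; otherwise P0^2 - 2 P0
    J is itself nonpositive.\<close>
  proof (cases "P0 \<le> J")
    case True
    have "P0 * P0 \<le> P0 * (2 * J)" using True P0_pos J by (intro mult_left_mono) auto
    then have "P0\<^sup>2 - 2 * P0 * J \<le> 0" by (simp add: power2_eq_square algebra_simps)
    then show ?thesis using zero_le_power2[of b] by linarith
  next
    case False
    have "P0 - J \<le> b" using d unfolding b_def by linarith
    then have "(P0 - J)\<^sup>2 \<le> b\<^sup>2" using False by (intro power_mono) auto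
    moreover have "(P0 - J)\<^sup>2 = P0\<^sup>2 - 2 * P0 * J + J\<^sup>2" by (simp add: power2_eq_square algebra_simps)
    ultimately show ?thesis using zero_le_power2[of J] by linarith
  qed
  then have "M * (P0\<^sup>2 - 2 * P0 * J) \<le> M * b\<^sup>2" using M by (intro mult_left_mono) auto
  moreover have "M * (P0\<^sup>2 - 2 * P0 * J) = M * P0\<^sup>2 - M * (2 * P0 * J)"
    by (rule right_diff_distrib)
  moreover have "P1 * Pm = b\<^sup>2 - c\<^sup>2" by (simp add: b_def c_def power2_eq_square field_simps)
  then have "M * (P1 * Pm) = M * b\<^sup>2 - M * c\<^sup>2" by (simp only: right_diff_distrib)
  moreover have "(M - 1) * P0\<^sup>2 = M * P0\<^sup>2 - P0\<^sup>2" by (simp add: algebra_simps)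
  moreover have "16 / 100 * (P0 * v) + 33 / 100 * v\<^sup>2 < P0\<^sup>2"
  proof -
    have "(77 / 100 * v) * (61 / 100 * v) \<le> P0 * (P0 - 16 / 100 * v)"
      using P0 v by (intro mult_mono) auto
    moreover have "33 / 100 * v\<^sup>2 < (77 / 100 * v) * (61 / 100 * v)" using v by (simp add: power2_eq_square)
    ultimately show ?thesis by (simp add: power2_eq_square algebra_simps)
  qed
  ultimately show ?thesis using Mc MJ by linarith
qed

lemma partition_number_ratio_large:
  fixes n :: nat
  assumes "900 \<le> n"
  shows "n * (partition_number n)\<^sup>2 < (n + 1) * (partition_number (n - 1) * partition_number (n + 1))"
proof -
  obtain t where t: "0 < t" and n: "(\<Sum>N. real N * log_coeff N * exp (- t) ^ N) = real n"
    using saddle_point_exists[of n] assms by auto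
  define x where "x = exp (- t)"
  have x: "0 < x" "x < 1" using t by (auto simp: x_def)
  \<comment> \<open>1645/1000 lies just above \<pi>^2/6, the constant of the first moment
    bound.\<close>
  have nt: "real n * t\<^sup>2 \<le> 1645 / 1000"
  proof -
    have "real n \<le> pi\<^sup>2 / 6 / t\<^sup>2" using log_coeff_moments(5)[OF t] n by simp
    then have "real n * t\<^sup>2 \<le> pi\<^sup>2 / 6" using t by (simp add: field_simps)
    moreover have "pi\<^sup>2 \<le> (31416 / 10000)\<^sup>2" using pi_approx by (intro power_mono) auto
    ultimately show ?thesis by (simp add: power2_eq_square)
  qed
  \<comment> \<open>The threshold 900 enters here: 1.645/900 is below 0.043^2.\<close>
  have t_le: "t \<le> 43 / 1000"
  proof (rule power2_le_imp_le)
    have "900 * t\<^sup>2 \<le> real n * t\<^sup>2" using assms by (intro mult_right_mono) auto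
    then show "t\<^sup>2 \<le> (43 / 1000)\<^sup>2" using nt by (simp add: power2_eq_square)
  qed simp
  define w where "w = sqrt t"
  have w: "0 < w" "t = w\<^sup>2" using t by (auto simp: w_def)
  define H where "H \<theta> = of_real (exp (- decay t \<theta>)) * cis (phase t \<theta>)" for \<theta>
  define C where "C = exp (log_gf (of_real x))"
  have C: "C \<noteq> 0" by (simp add: C_def)
  \<comment> \<open>C is a sum of real terms, so division by it leaves the Fourier coefficients
    \<open>Q m\<close> real.\<close>
  have "(\<lambda>k. complex_of_real (partition_number k * x ^ k)) sums C"
    using partition_gf_sums[of "of_real x"] x by (simp add: C_def)
  then have "(\<lambda>k. Im (complex_of_real (partition_number k * x ^ k))) sums Im C" by (rule sums_Im)
  then have "(\<lambda>k. 0) sums Im C" by simp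
  then have "Im C = 0" using sums_zero by (rule sums_unique2)
  then obtain F where F: "C = of_real F" by (metis complex_is_Real_iff Reals_cases)
  have F_nz: "F \<noteq> 0" using C F by auto
  have polar: "exp (log_gf (of_real x * cis \<theta>)) * cis (- (of_nat n * \<theta>)) = C * H \<theta>" for \<theta>
    unfolding x_def C_def H_def using t n by (rule exp_log_gf_polar)
  define Q where "Q m = 2 * pi * partition_number m * x ^ m / F" for m
  have Q: "((\<lambda>\<theta>. H \<theta> * cis ((real n - real m) * \<theta>)) has_integral of_real (Q m)) {-pi..pi}" for m
  proof -
    have "((\<lambda>\<theta>. exp (log_gf (of_real x * cis \<theta>)) * cis (- (of_nat m * \<theta>)) / C) has_integral
        (of_real (2 * pi * partition_number m * x ^ m) / C)) {-pi..pi}"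
      by (intro has_integral_divide fourier_coefficient_partition_gf x)
    moreover have "exp (log_gf (of_real x * cis \<theta>)) * cis (- (of_nat m * \<theta>)) / C = H \<theta> * cis ((real n - real m) * \<theta>)" for \<theta>
    proof -
      have "cis (- (of_nat m * \<theta>)) = cis (- (of_nat n * \<theta>)) * cis ((real n - real m) * \<theta>)"
        by (simp add: cis_mult algebra_simps)
      then have "exp (log_gf (of_real x * cis \<theta>)) * cis (- (of_nat m * \<theta>))
          = (exp (log_gf (of_real x * cis \<theta>)) * cis (- (of_nat n * \<theta>))) * cis ((real n - real m) * \<theta>)"
        by (simp add: mult.assoc)
      then show ?thesis unfolding polar using C by simp
    qed
    ultimately show ?thesis by (simp add: Q_def F)
  qed
  have P0: "(H has_integral of_real (Q n)) {-pi..pi}" using Q[of n] by simp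
  have P1: "((\<lambda>\<theta>. H \<theta> * cis (- \<theta>)) has_integral of_real (Q (n + 1))) {-pi..pi}"
    using Q[of "n + 1"] by simp
  have Pm: "((\<lambda>\<theta>. H \<theta> * cis \<theta>) has_integral of_real (Q (n - 1))) {-pi..pi}"
    using Q[of "n - 1"] assms by (simp add: of_nat_diff)
  have norm_H: "norm (H \<theta>) = exp (- decay t \<theta>)" for \<theta> by (simp add: H_def norm_mult)
  \<comment> \<open>Continuity is inherited from the holomorphic \<open>log_gf\<close> through the
    polar form, not proved from the series for \<open>decay\<close>.\<close>
  have cont: "continuous_on {-pi..pi} (\<lambda>\<theta>. exp (- decay t \<theta>))"
  proof -
    have "continuous_on (ball 0 1) log_gf"
      using holomorphic_log_gf by (rule holomorphic_on_imp_continuous_on)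
    then have "continuous_on {-pi..pi} (\<lambda>\<theta>. log_gf (of_real x * cis \<theta>))"
      by (rule continuous_on_compose2) (use x in \<open>auto intro!: continuous_intros simp: norm_mult\<close>)
    then have "continuous_on {-pi..pi} (\<lambda>\<theta>. norm (exp (log_gf (of_real x * cis \<theta>)) * cis (- (of_nat n * \<theta>)) / C))"
      using C by (intro continuous_intros) auto
    then show ?thesis unfolding polar using C by (simp add: norm_H)
  qed
  define I where "I = integral {-pi..pi} (\<lambda>\<theta>. exp (- decay t \<theta>))"
  define J where "J = integral {-pi..pi} (\<lambda>\<theta>. exp (- decay t \<theta>) * (1 - cos \<theta>))"
  have I: "((\<lambda>\<theta>. exp (- decay t \<theta>)) has_integral I) {-pi..pi}"
    unfolding I_def by (intro integrable_integral integrable_continuous_real cont)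
  have J: "((\<lambda>\<theta>. exp (- decay t \<theta>) * (1 - cos \<theta>)) has_integral J) {-pi..pi}"
    unfolding J_def
    by (intro integrable_integral integrable_continuous_real continuous_on_mult[OF cont]
          continuous_on_diff continuous_on_const continuous_on_cos continuous_on_id)
  have J_nonneg: "0 \<le> J" using J by (rule has_integral_nonneg) simp
  have "((\<lambda>\<theta>. Re (H \<theta>)) has_integral Re (of_real (Q n))) {-pi..pi}"
    using has_integral_linear[OF P0 bounded_linear_Re] by (simp add: o_def)
  then have "((\<lambda>\<theta>. exp (- decay t \<theta>) * cos (phase t \<theta>)) has_integral Q n) {-pi..pi}"
    by (simp add: H_def)
  then have Q_ge: "77 / 100 * w ^ 3 \<le> Q n"
    by (rule integral_exp_decay_cos_phase_ge[OF w t_le])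
  have I_le: "I \<le> 21 / 10 * w ^ 3"
    using I by (rule integral_exp_decay_le[OF w t_le])
  have J_le: "J \<le> 108 / 100 * (w ^ 3) ^ 3"
    using integral_exp_decay_cos_le[OF w t_le J] by (simp flip: power_mult)
  have M: "(real n + 1) * (w ^ 3)\<^sup>2 \<le> 71 / 1000"
  proof -
    have "(real n + 1) * (w ^ 3)\<^sup>2 = (real n * t\<^sup>2 + t\<^sup>2) * t"
      by (simp add: w(2) algebra_simps flip: power_mult power_add)
    also have "\<dots> \<le> (1645 / 1000 + (43 / 1000)\<^sup>2) * (43 / 1000)"
      using nt t t_le by (intro mult_mono add_mono power_mono) auto
    finally show ?thesis by (simp add: power2_eq_square)
  qed
  have main: "(real n + 1 - 1) * (Q n)\<^sup>2 < (real n + 1) * (Q (n + 1) * Q (n - 1))"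
  proof (rule product_of_neighbours_ge[OF _ _ M Q_ge I_le J_nonneg J_le])
    have w3: "0 < w ^ 3" using w by simp
    show "\<bar>Q n - (Q (n + 1) + Q (n - 1)) / 2\<bar> \<le> J"
      "\<bar>(Q (n + 1) - Q (n - 1)) / 2\<bar> \<le> w ^ 3 / 2 * I + J / w ^ 3"
      using adjacent_fourier_bounds[OF P0 P1 Pm, of I J "w ^ 3"] I J w3 by (auto simp: norm_H)
  qed (use w in auto)
  define a b where "a = real ((partition_number n)\<^sup>2)"
    and "b = real (partition_number (n - 1) * partition_number (n + 1))"
  \<comment> \<open>The exponents n - 1 and n + 1 add up to 2n, so both sides carry the same
    positive factor and it cancels.\<close>
  define D where "D = (2 * pi / F)\<^sup>2 * (x ^ n)\<^sup>2"
  have D: "0 < D" using x F_nz by (simp add: D_def)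
  have q0: "(Q n)\<^sup>2 = D * a"
    by (simp add: Q_def D_def a_def power_mult_distrib power_divide)
  have q1: "Q (n + 1) * Q (n - 1) = D * b"
  proof -
    obtain k where k: "n = Suc k" using assms by (cases n) auto
    have "x ^ (n + 1) * x ^ (n - 1) = (x ^ n)\<^sup>2" by (simp add: k power2_eq_square)
    moreover have "Q (n + 1) * Q (n - 1) = (2 * pi / F)\<^sup>2 * (x ^ (n + 1) * x ^ (n - 1)) * b"
      by (simp add: Q_def b_def power2_eq_square)
    ultimately show ?thesis by (simp only: D_def)
  qed
  have "D * (real n * a) < D * ((real n + 1) * b)"
    using main unfolding q0 q1 by (simp add: mult.left_commute)
  then have "real n * a < (real n + 1) * b"
    using D by (simp only: mult_less_cancel_left_pos)
  then have "real (n * (partition_number n)\<^sup>2)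
      < real ((n + 1) * (partition_number (n - 1) * partition_number (n + 1)))"
    by (simp add: a_def b_def algebra_simps)
  then show ?thesis by (simp only: of_nat_less_iff)
qed

theorem theorem4p1:
  fixes n :: nat
  assumes "n > 1"
  shows "real (partition_number (n - 1)) / real (partition_number n) * (1 + 1 / real n)
           > real (partition_number n) / real (partition_number (n + 1))"
proof -
  define a b c where "a = real (partition_number (n - 1))" and "b = real (partition_number n)"
    and "c = real (partition_number (n + 1))"
  have pos: "0 < a" "0 < b" "0 < c" "0 < real n"
    using partition_number_pos assms by (auto simp: a_def b_def c_def)
  have "n * (partition_number n)\<^sup>2 < (n + 1) * (partition_number (n - 1) * partition_number (n + 1))"
    using assms partition_number_ratio_small partition_number_ratio_large
    by (cases "n < 900") auto
  then have "real (n * (partition_number n)\<^sup>2) < real ((n + 1) * (partition_number (n - 1) * partition_number (n + 1)))"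
    by (simp only: of_nat_less_iff)
  then have "real n * (b * b) < (real n + 1) * (a * c)"
    by (simp add: a_def b_def c_def power2_eq_square algebra_simps)
  then have "b / c < a / b * (1 + 1 / real n)"
    using pos by (simp add: field_simps)
  then show ?thesis unfolding a_def b_def c_def .
qed

end
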